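(* Let $\mathcal C=\langle x,y\mid \text{3-step nilpotent}\rangle$ be the Cartan group with generating set $S=\{x^{\pm1},y^{\pm1}\}$, and let $(\gamma_u)_{u\in\mathbb S^1}$ be the family of geodesic rays in $\mathcal C$ parametrized by unit vectors $u\in\mathbb S^1\subset\mathbb R^2$ described in the context. Then the Busemann points $b_{\gamma_u}$, $u\in\mathbb S^1$, are pairwise distinct, and for each $u$ the $\mathcal C$-orbit of $[b_{\gamma_u}]$ in the reduced horoboundary $\partial^r(\mathcal C,S)$ is infinite.
   Context: Horofunctions. For a group $G$ with finite symmetric generating set $S$ and word metric $d_S$, put $\varphi_g(\ast)=d_S(g,\ast)-d_S(g,e)$ and $\iota(g)=\varphi_g$, in the space of functions $G\to\mathbb R$ with pointwise convergence. The horoboundary is $\partial(G,S)=\overline{\iota(G)}\setminus\iota(G)$. For a geodesic ray $\gamma=(\gamma_n)_{n\ge0}$, the Busemann point is $b_\gamma=\lim_n\varphi_{\gamma_n}\in\partial(G,S)$. The group acts by $(g\cdot\varphi)(h)=\varphi(g^{-1}h)-\varphi(g^{-1})$. The reduced horoboundary $\partial^r(G,S)$ is the quotient of $\partial(G,S)$ identifying two horofunctions whose difference is bounded; the class of $\varphi$ is $[\varphi]$, and $G$ acts on $\partial^r(G,S)$. The group $\mathcal C$ is the free $3$-step nilpotent group of rank $2$ on $x,y$. The abelianization map is $\mathcal C\to\mathbb Z^2$, $g\mapsto\hat g$, with $\hat x=(1,0)$, $\hat y=(0,1)$. The rays $\gamma_u$. For $u\in\mathbb S^1$, $\gamma_u=(\gamma_{u,n})_{n\ge0}$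 is the path in the Cayley graph of $(\mathcal C,S)$ with $\gamma_{u,0}=e$ that lifts the following infinite lattice path $\hat\gamma_u$ in $\mathbb Z^2$ starting at the origin. If $u\in\{(\pm1,0),(0,\pm1)\}$, $\hat\gamma_u$ is the straight path along the ray $\mathbb R^+u$. Otherwise let $Q$ be the closed quadrant containing $u$. Divide the unit squares of the integer grid contained in $Q$ into two categories according to the side of the ray $\mathbb R^+u$ on which their center lies; $\hat\gamma_u$ is the lattice path from the origin in $Q$, using only the two unit steps pointing into $Q$, such that the squares of one category all lie on one side of the path and the squares of the other category on the other side. Squares whose center lies exactly on the ray (which happens only when $u$ is a positive multiple of $(a,b)$ with $a,b$ odd integers) are assigned alternately to the two categories, in order of distance from the origin. The path $\hat\gamma_u$ is geodesic in $\mathbb Z^2$, so $\gamma_u$ is geodesic in $\mathcal C$. *)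

theory Defs
  imports "HOL-Analysis.Analysis" "HOL-Algebra.Group_Action"
begin

section \<open>Word metrics and horoboundaries\<close>

definition word_length :: "('a, 'b) monoid_scheme \<Rightarrow> 'a set \<Rightarrow> 'a \<Rightarrow> nat" where
  "word_length G S g =
     (LEAST n. \<exists>ws. length ws = n \<and> set ws \<subseteq> S \<and> foldr (\<lambda>a b. a \<otimes>\<^bsub>G\<^esub> b) ws \<one>\<^bsub>G\<^esub> = g)"

definition word_dist :: "('a, 'b) monoid_scheme \<Rightarrow> 'a set \<Rightarrow> 'a \<Rightarrow> 'a \<Rightarrow> nat" where
  "word_dist G S g h = word_length G S (inv\<^bsub>G\<^esub> g \<otimes>\<^bsub>G\<^esub> h)"

text \<open>Functions on the group are extensional functions on its carrier, so that the space of all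
  of them with pointwise convergence is the library's product topology.\<close>

definition horo_embed :: "('a, 'b) monoid_scheme \<Rightarrow> 'a set \<Rightarrow> 'a \<Rightarrow> 'a \<Rightarrow> real" where
  "horo_embed G S g =
     (\<lambda>h\<in>carrier G. real (word_dist G S g h) - real (word_dist G S g \<one>\<^bsub>G\<^esub>))"

definition horoboundary :: "('a, 'b) monoid_scheme \<Rightarrow> 'a set \<Rightarrow> ('a \<Rightarrow> real) set" where
  "horoboundary G S =
     Abstract_Topology.closure_of (product_topology (\<lambda>_. euclideanreal) (carrier G))
       (horo_embed G S ` carrier G) - horo_embed G S ` carrier G"

definition busemann :: "('a, 'b) monoid_scheme \<Rightarrow> 'a set \<Rightarrow> (nat \<Rightarrow> 'a) \<Rightarrow> 'a \<Rightarrow> real" where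
  "busemann G S \<gamma> = (\<lambda>h\<in>carrier G. lim (\<lambda>n. horo_embed G S (\<gamma> n) h))"

definition horo_act :: "('a, 'b) monoid_scheme \<Rightarrow> 'a \<Rightarrow> ('a \<Rightarrow> real) \<Rightarrow> 'a \<Rightarrow> real" where
  "horo_act G g \<phi> = (\<lambda>h\<in>carrier G. \<phi> (inv\<^bsub>G\<^esub> g \<otimes>\<^bsub>G\<^esub> h) - \<phi> (inv\<^bsub>G\<^esub> g))"

definition horo_rel :: "('a, 'b) monoid_scheme \<Rightarrow> 'a set \<Rightarrow> (('a \<Rightarrow> real) \<times> ('a \<Rightarrow> real)) set" where
  "horo_rel G S = {(\<phi>, \<psi>). \<phi> \<in> horoboundary G S \<and> \<psi> \<in> horoboundary G S \<and>
     (\<exists>B. \<forall>h\<in>carrier G. \<bar>\<phi> h - \<psi> h\<bar> \<le> B)}"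

definition reduced_horoboundary ::
  "('a, 'b) monoid_scheme \<Rightarrow> 'a set \<Rightarrow> ('a \<Rightarrow> real) set set" where
  "reduced_horoboundary G S = horoboundary G S // horo_rel G S"


definition horo_class ::
  "('a, 'b) monoid_scheme \<Rightarrow> 'a set \<Rightarrow> ('a \<Rightarrow> real) \<Rightarrow> ('a \<Rightarrow> real) set" where
  "horo_class G S \<phi> = horo_rel G S `` {\<phi>}"

lemma horo_class_in_reduced_horoboundary:
  assumes "\<phi> \<in> horoboundary G S"
  shows "horo_class G S \<phi> \<in> reduced_horoboundary G S"
  unfolding reduced_horoboundary_def horo_class_def using assms by (rule quotientI)

text \<open>An equivalence class is moved by moving its members. The class of a function outside the
  horoboundary is empty and fixed by the action, so an infinite orbit of classes can only occur
  for functions in the horoboundary.\<close>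

definition reduced_act ::
  "('a, 'b) monoid_scheme \<Rightarrow> 'a \<Rightarrow> ('a \<Rightarrow> real) set \<Rightarrow> ('a \<Rightarrow> real) set" where
  "reduced_act G g A = horo_act G g ` A"


section \<open>The free 3-step nilpotent group of rank 2\<close>

text \<open>Words in the two generators and their formal inverses; the flag \<open>True\<close> marks an inverse.\<close>

datatype gen = X | Y

type_synonym word = "(gen \<times> bool) list"

definition word_inv :: "word \<Rightarrow> word" where
  "word_inv w = rev (map (\<lambda>(s, e). (s, \<not> e)) w)"

definition word_comm :: "word \<Rightarrow> word \<Rightarrow> word" where
  "word_comm v w = word_inv v @ word_inv w @ v @ w"

text \<open>The congruence presenting the group: free cancellation together with triviality of every
  fourfold commutator, i.e. the free group modulo the fourth term of its lower central series.\<close>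

inductive cartan_eq :: "word \<Rightarrow> word \<Rightarrow> bool" where
  refl: "cartan_eq w w"
| sym: "cartan_eq v w \<Longrightarrow> cartan_eq w v"
| trans: "cartan_eq u v \<Longrightarrow> cartan_eq v w \<Longrightarrow> cartan_eq u w"
| append: "cartan_eq v v' \<Longrightarrow> cartan_eq w w' \<Longrightarrow> cartan_eq (v @ w) (v' @ w')"
| cancel: "cartan_eq (w @ word_inv w) []"
| nilpotent: "cartan_eq (word_comm (word_comm (word_comm a b) c) d) []"

lemma word_inv_append: "word_inv (v @ w) = word_inv w @ word_inv v"
  by (simp add: word_inv_def)

lemma word_inv_word_inv [simp]: "word_inv (word_inv w) = w"
  by (simp add: word_inv_def rev_map comp_def case_prod_beta)

lemma cartan_eq_word_inv_left: "cartan_eq (word_inv w @ w) []"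
  using cartan_eq.cancel[of "word_inv w"] by simp

quotient_type cartan = word / cartan_eq
  by (auto intro!: equivpI reflpI sympI transpI intro: cartan_eq.intros)

lift_definition cartan_mult :: "cartan \<Rightarrow> cartan \<Rightarrow> cartan" is "(@)"
  by (rule cartan_eq.append)

lift_definition cartan_one :: cartan is "[]" .

lift_definition cartan_gen :: "gen \<Rightarrow> cartan" is "\<lambda>s. [(s, False)]" .

definition cartan_group :: "cartan monoid" where
  "cartan_group = \<lparr>carrier = UNIV, mult = cartan_mult, one = cartan_one\<rparr>"

lemma group_cartan_group: "group cartan_group"
proof (rule groupI)
  fix g assume "g \<in> carrier cartan_group"
  have "\<exists>h. cartan_mult h g = cartan_one"
    by transfer (blast intro: cartan_eq_word_inv_left)
  then show "\<exists>h\<in>carrier cartan_group. h \<otimes>\<^bsub>cartan_group\<^esub> g = \<one>\<^bsub>cartan_group\<^esub>"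
    by (simp add: cartan_group_def)
qed (auto simp: cartan_group_def, (transfer, simp add: cartan_eq.refl)+)

definition cartan_gens :: "cartan set" where
  "cartan_gens = {cartan_gen X, inv\<^bsub>cartan_group\<^esub> cartan_gen X,
                  cartan_gen Y, inv\<^bsub>cartan_group\<^esub> cartan_gen Y}"

fun letter_ab :: "gen \<times> bool \<Rightarrow> int \<times> int" where
  "letter_ab (X, e) = (if e then - 1 else 1, 0)"
| "letter_ab (Y, e) = (0, if e then - 1 else 1)"

definition word_ab :: "word \<Rightarrow> int \<times> int" where
  "word_ab w = (\<Sum>l\<leftarrow>w. letter_ab l)"

lemma word_ab_append [simp]: "word_ab (v @ w) = word_ab v + word_ab w"
  by (simp add: word_ab_def)

lemma word_ab_word_inv [simp]: "word_ab (word_inv w) = - word_ab w"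
proof (induction w)
  case Nil
  show ?case by (simp add: word_ab_def word_inv_def)
next
  case (Cons l w)
  obtain s e where l: "l = (s, e)" by (cases l)
  have "letter_ab (s, \<not> e) = - letter_ab (s, e)" by (cases s) auto
  then show ?case using Cons by (simp add: word_ab_def word_inv_def l)
qed

lift_definition cartan_ab :: "cartan \<Rightarrow> int \<times> int" is word_ab
proof -
  fix v w assume "cartan_eq v w"
  then show "word_ab v = word_ab w"
    by induction (simp_all add: word_comm_def, simp_all add: word_ab_def)
qed


section \<open>The rays\<close>

text \<open>Fix \<open>u\<close> off the coordinate axes and let \<open>Q\<close> be the closed quadrant containing it. The unit
  squares in \<open>Q\<close> are indexed by pairs of natural numbers: the centre of square \<open>(i, j)\<close> has absolute
  coordinates \<open>(i + 1/2, j + 1/2)\<close>. Reflecting \<open>Q\<close> onto the positive quadrant, the following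
  number is positive, negative or zero according as the centre lies on the side of the vertical
  axis, on the side of the horizontal axis, or on the ray through \<open>u\<close>.\<close>

definition ray_offset :: "real \<times> real \<Rightarrow> nat \<Rightarrow> nat \<Rightarrow> real" where
  "ray_offset u i j = \<bar>fst u\<bar> * (real j + 1/2) - \<bar>snd u\<bar> * (real i + 1/2)"

text \<open>\<open>A i j\<close> says that square \<open>(i, j)\<close> is in the category of the squares on the vertical-axis side.
  Distance from the origin increases with \<open>i\<close> along the squares centred on the ray; which
  category the first of these belongs to is left open.\<close>

definition square_division :: "real \<times> real \<Rightarrow> (nat \<Rightarrow> nat \<Rightarrow> bool) \<Rightarrow> bool" where
  "square_division u A \<longleftrightarrow>
     (\<forall>i j. ray_offset u i j > 0 \<longrightarrow> A i j) \<and>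
     (\<forall>i j. ray_offset u i j < 0 \<longrightarrow> \<not> A i j) \<and>
     (\<forall>i j i' j'. ray_offset u i j = 0 \<and> ray_offset u i' j' = 0 \<and> i < i' \<and>
        (\<forall>k l. i < k \<and> k < i' \<longrightarrow> ray_offset u k l \<noteq> 0) \<longrightarrow> A i' j' \<noteq> A i j)"

text \<open>A monotone path in \<open>Q\<close> leaves square \<open>(i, j)\<close> on its vertical-axis side iff it passes between
  the square and the horizontal axis, i.e. visits a vertex with absolute coordinates \<open>(a, b)\<close>,
  \<open>a \<ge> i + 1\<close> and \<open>b \<le> j\<close>; symmetrically for the other side.\<close>

definition vertical_side :: "(nat \<Rightarrow> int \<times> int) \<Rightarrow> nat \<Rightarrow> nat \<Rightarrow> bool" where
  "vertical_side p i j \<longleftrightarrow> (\<exists>n. \<bar>fst (p n)\<bar> \<ge> int i + 1 \<and> \<bar>snd (p n)\<bar> \<le> int j)"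

definition horizontal_side :: "(nat \<Rightarrow> int \<times> int) \<Rightarrow> nat \<Rightarrow> nat \<Rightarrow> bool" where
  "horizontal_side p i j \<longleftrightarrow> (\<exists>n. \<bar>fst (p n)\<bar> \<le> int i \<and> \<bar>snd (p n)\<bar> \<ge> int j + 1)"

text \<open>\<open>\<lfloor>sgn r\<rfloor>\<close> is the sign of \<open>r\<close> as an integer.\<close>

definition lattice_ray :: "real \<times> real \<Rightarrow> (nat \<Rightarrow> int \<times> int) \<Rightarrow> bool" where
  "lattice_ray u p \<longleftrightarrow>
     (if fst u = 0 \<or> snd u = 0
      then \<forall>n. p n = (int n * \<lfloor>sgn (fst u)\<rfloor>, int n * \<lfloor>sgn (snd u)\<rfloor>)
      else p 0 = (0, 0) \<and>
        (\<forall>n. p (Suc n) - p n \<in> {(\<lfloor>sgn (fst u)\<rfloor>, 0), (0, \<lfloor>sgn (snd u)\<rfloor>)}) \<and>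
        (\<exists>A. square_division u A \<and>
           (\<forall>i j. A i j \<longrightarrow> vertical_side p i j) \<and>
           (\<forall>i j. \<not> A i j \<longrightarrow> horizontal_side p i j)))"

definition cartan_ray :: "real \<times> real \<Rightarrow> (nat \<Rightarrow> cartan) \<Rightarrow> bool" where
  "cartan_ray u \<gamma> \<longleftrightarrow>
     \<gamma> 0 = \<one>\<^bsub>cartan_group\<^esub> \<and>
     (\<forall>n. \<exists>s\<in>cartan_gens. \<gamma> (Suc n) = \<gamma> n \<otimes>\<^bsub>cartan_group\<^esub> s) \<and>
     lattice_ray u (\<lambda>n. cartan_ab (\<gamma> n))"

text \<open>Rays exist in every direction. Off the axes, step along the horizontal direction exactly when
  the next square belongs to the vertical-axis category.\<close>

primrec greedy :: "(nat \<Rightarrow> nat \<Rightarrow> bool) \<Rightarrow> nat \<Rightarrow> nat \<times> nat" where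
  "greedy A 0 = (0, 0)"
| "greedy A (Suc n) = (case greedy A n of (a, b) \<Rightarrow> if A a b then (Suc a, b) else (a, Suc b))"

lemma greedy_sum: "fst (greedy A n) + snd (greedy A n) = n"
  by (induction n) (auto split: prod.splits)

lemma greedy_sides:
  assumes up: "\<And>i j j'. A i j \<Longrightarrow> j \<le> j' \<Longrightarrow> A i j'"
    and left: "\<And>i j i'. A i j \<Longrightarrow> i' \<le> i \<Longrightarrow> A i' j"
  shows "(\<forall>i j. fst (greedy A n) \<le> i \<and> j < snd (greedy A n) \<longrightarrow> \<not> A i j) \<and>
     (\<forall>i j. i < fst (greedy A n) \<and> snd (greedy A n) \<le> j \<longrightarrow> A i j)"
proof (induction n)
  case (Suc n)
  obtain a b where ab: "greedy A n = (a, b)" by force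
  from Suc have IH: "\<And>i j. a \<le> i \<Longrightarrow> j < b \<Longrightarrow> \<not> A i j" "\<And>i j. i < a \<Longrightarrow> b \<le> j \<Longrightarrow> A i j"
    by (simp_all add: ab)
  show ?case
  proof (cases "A a b")
    case True
    then have "A i j" if "i < Suc a" "b \<le> j" for i j
      using that IH(2) up less_Suc_eq by metis
    then show ?thesis using True IH(1) by (simp add: ab)
  next
    case False
    then have "\<not> A i j" if "a \<le> i" "j < Suc b" for i j
      using that IH(1) left less_Suc_eq by metis
    then show ?thesis using False IH(2) by (simp add: ab)
  qed
qed auto

lemma offset_mono:
  assumes "fst u \<noteq> 0" "snd u \<noteq> 0"
  shows "j < j' \<Longrightarrow> ray_offset u i j < ray_offset u i j'"
    "i' < i \<Longrightarrow> ray_offset u i j < ray_offset u i' j"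
  using assms by (auto simp: ray_offset_def)

lemma division_exists:
  assumes u: "fst u \<noteq> 0" "snd u \<noteq> 0"
  defines "T \<equiv> {k. \<exists>l. ray_offset u k l = 0}"
  defines "A \<equiv> \<lambda>i j. ray_offset u i j > 0 \<or> ray_offset u i j = 0 \<and> even (card (T \<inter> {..<i}))"
  shows "square_division u A"
proof -
  have "A i' j' \<noteq> A i j" if *: "ray_offset u i j = 0" "ray_offset u i' j' = 0" "i < i'"
    "\<And>k l. i < k \<Longrightarrow> k < i' \<Longrightarrow> ray_offset u k l \<noteq> 0" for i j i' j'
  proof -
    have "T \<inter> {..<i'} = insert i (T \<inter> {..<i})"
      using * by (auto simp: T_def) (metis linorder_neqE_nat)
    then have "card (T \<inter> {..<i'}) = Suc (card (T \<inter> {..<i}))" by simp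
    then show ?thesis using * by (simp add: A_def)
  qed
  then show ?thesis unfolding square_division_def by (auto simp: A_def)
qed

lemma floor_sgn: "r \<noteq> 0 \<Longrightarrow> \<lfloor>sgn r\<rfloor> = 1 \<or> \<lfloor>sgn r\<rfloor> = - 1" for r :: real
  by (simp add: sgn_if) linarith

lemma lattice_ray_exists:
  assumes u: "u \<in> sphere (0, 0) (1::real)"
  shows "\<exists>p. lattice_ray u p \<and> p 0 = (0,0) \<and>
     (\<forall>n. p (Suc n) - p n \<in> {(1,0),(-1,0),(0,1),(0,-1)})"
proof (cases "fst u = 0 \<or> snd u = 0")
  case True
  have nz: "\<not> (fst u = 0 \<and> snd u = 0)" using u by (cases u) auto
  show ?thesis using True nz
    by (intro exI[of _ "\<lambda>n. (int n * \<lfloor>sgn (fst u)\<rfloor>, int n * \<lfloor>sgn (snd u)\<rfloor>)"])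
      (use floor_sgn[of "fst u"] floor_sgn[of "snd u"] in \<open>auto simp: lattice_ray_def algebra_simps\<close>)
next
  case False
  then have u0: "fst u \<noteq> 0" "snd u \<noteq> 0" by auto
  define T where "T = {k. \<exists>l. ray_offset u k l = 0}"
  define A where "A = (\<lambda>i j. ray_offset u i j > 0 \<or> ray_offset u i j = 0 \<and> even (card (T \<inter> {..<i})))"
  have div: "square_division u A"
    using division_exists[OF u0] by (simp add: A_def T_def)
  have up: "A i j'" if "A i j" "j \<le> j'" for i j j'
    using that offset_mono(1)[OF u0, of j j' i] unfolding A_def by (cases "j = j'") auto
  have left: "A i' j" if "A i j" "i' \<le> i" for i j i'
    using that offset_mono(2)[OF u0, of i' i j] unfolding A_def by (cases "i = i'") auto
  define p where "p = (\<lambda>n. (int (fst (greedy A n)) * \<lfloor>sgn (fst u)\<rfloor>, int (snd (greedy A n)) * \<lfloor>sgn (snd u)\<rfloor>))"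
  have ab: "\<bar>fst (p n)\<bar> = int (fst (greedy A n))" "\<bar>snd (p n)\<bar> = int (snd (greedy A n))" for n
    using floor_sgn[OF u0(1)] floor_sgn[OF u0(2)] by (auto simp: p_def)
  have sides: "(\<forall>i j. fst (greedy A n) \<le> i \<and> j < snd (greedy A n) \<longrightarrow> \<not> A i j) \<and>
      (\<forall>i j. i < fst (greedy A n) \<and> snd (greedy A n) \<le> j \<longrightarrow> A i j)" for n
    by (rule greedy_sides; erule (1) up left)
  have v: "vertical_side p i j" if "A i j" for i j
  proof -
    have "\<not> (fst (greedy A (i+j+1)) \<le> i \<and> j < snd (greedy A (i+j+1)))"
      using sides that by blast
    then have "fst (greedy A (i+j+1)) \<ge> i + 1 \<and> snd (greedy A (i+j+1)) \<le> j"
      using greedy_sum[of A "i+j+1"] by linarith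
    then show ?thesis
      unfolding vertical_side_def ab by (intro exI[of _ "i+j+1"]) linarith
  qed
  have h: "horizontal_side p i j" if "\<not> A i j" for i j
  proof -
    have "\<not> (i < fst (greedy A (i+j+1)) \<and> snd (greedy A (i+j+1)) \<le> j)"
      using sides that by blast
    then have "fst (greedy A (i+j+1)) \<le> i \<and> snd (greedy A (i+j+1)) \<ge> j + 1"
      using greedy_sum[of A "i+j+1"] by linarith
    then show ?thesis
      unfolding horizontal_side_def ab by (intro exI[of _ "i+j+1"]) linarith
  qed
  have st: "p (Suc n) - p n \<in> {(\<lfloor>sgn (fst u)\<rfloor>, 0), (0, \<lfloor>sgn (snd u)\<rfloor>)}" for n
    by (auto simp: p_def algebra_simps split: prod.splits)
  have "lattice_ray u p"
    unfolding lattice_ray_def if_not_P[OF False]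
    using div v h st by (intro conjI exI[of _ A]) (simp_all add: p_def)
  moreover have "p 0 = (0, 0)" by (simp add: p_def)
  moreover have "p (Suc n) - p n \<in> {(1,0),(-1,0),(0,1),(0,-1)}" for n
    using st[of n] floor_sgn[OF u0(1)] floor_sgn[OF u0(2)] by auto
  ultimately show ?thesis by blast
qed

lemma ab_mult: "cartan_ab (cartan_mult g h) = cartan_ab g + cartan_ab h"
  by transfer simp

lemma ab_one: "cartan_ab cartan_one = 0" by transfer (simp add: word_ab_def)
lemma ab_gen: "cartan_ab (cartan_gen s) = letter_ab (s, False)"
  by transfer (simp add: word_ab_def)

lemma ab_inv: "cartan_ab (inv\<^bsub>cartan_group\<^esub> g) = - cartan_ab g"
proof -
  have "inv\<^bsub>cartan_group\<^esub> g \<otimes>\<^bsub>cartan_group\<^esub> g = \<one>\<^bsub>cartan_group\<^esub>"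
    by (rule group.l_inv[OF group_cartan_group]) (simp add: cartan_group_def)
  then have "cartan_mult (inv\<^bsub>cartan_group\<^esub> g) g = cartan_one"
    by (simp add: cartan_group_def)
  then have "cartan_ab (inv\<^bsub>cartan_group\<^esub> g) + cartan_ab g = 0"
    by (simp flip: ab_mult add: ab_one)
  then show ?thesis by (rule eq_neg_iff_add_eq_0[THEN iffD2])
qed

lemma cartan_ray_exists:
  assumes u: "u \<in> sphere (0, 0) (1::real)"
  shows "\<exists>\<gamma>. cartan_ray u \<gamma>"
proof -
  obtain p where p: "lattice_ray u p" "p 0 = (0,0)"
     "\<And>n. p (Suc n) - p n \<in> {(1,0),(-1,0),(0,1),(0,-1)}"
    using lattice_ray_exists[OF u] by blast
  have "\<exists>s\<in>cartan_gens. cartan_ab s = v" if "v \<in> {(1,0),(-1,0),(0,1),(0,-1)}" for v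
    using that unfolding cartan_gens_def bex_simps ab_inv ab_gen by auto
  from this[OF p(3)] have "\<forall>n. \<exists>s. s \<in> cartan_gens \<and> cartan_ab s = p (Suc n) - p n"
    by blast
  from choice[OF this] obtain s
    where s: "\<forall>n. s n \<in> cartan_gens \<and> cartan_ab (s n) = p (Suc n) - p n" ..
  define \<gamma> where "\<gamma> = rec_nat cartan_one (\<lambda>n g. cartan_mult g (s n))"
  have \<gamma>: "\<gamma> 0 = cartan_one" "\<gamma> (Suc n) = cartan_mult (\<gamma> n) (s n)" for n
    by (simp_all add: \<gamma>_def)
  have "cartan_ab (\<gamma> n) = p n" for n
  proof (induction n)
    case 0
    show ?case by (simp add: \<gamma>(1) ab_one p(2) zero_prod_def)
  next
    case (Suc n)
    have "cartan_ab (s n) = p (Suc n) - p n" using s by blast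
    with Suc show ?case by (simp only: \<gamma>(2) ab_mult) simp
  qed
  then have "(\<lambda>n. cartan_ab (\<gamma> n)) = p" by (rule ext)
  moreover have "\<exists>t\<in>cartan_gens. \<gamma> (Suc n) = cartan_mult (\<gamma> n) t" for n
    using s by (intro bexI[of _ "s n"] \<gamma>(2)) simp
  ultimately have "cartan_ray u \<gamma>"
    using p(1) by (simp add: cartan_ray_def cartan_group_def \<gamma>(1))
  then show ?thesis by (rule exI[of _ \<gamma>])
qed

end

theory Submission
  imports Defs "HOL-Real_Asymp.Real_Asymp"
begin

text \<open>The edge counts of a lattice path with a weight \<open>b\<^sup>2 - 2s(a + 1/2)b + f(a)\<close> on horizontal edges are iterated
  integrals of order at most three, hence depend only on the element of the Cartan group. With
  \<open>f\<close> chosen suitably the weight becomes \<open>(b - x)\<^sup>2 - dist(x, \<int>)\<^sup>2\<close>, \<open>x = s(a + 1/2)\<close>: nonnegative, and zero exactly on the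
  edges of the lattice path closest to the line of slope \<open>s\<close>. A symmetry of the generators turns every
  ray \<open>\<gamma>\<^sub>u\<close> into such a path with positive letters and slope \<open>s \<ge> 0\<close>.

  If \<open>b\<^sub>u = b\<^sub>v\<close>, then \<open>\<gamma>\<^sub>v\<close> can be continued to geodesics ending on \<open>\<gamma>\<^sub>u\<close>; these have total weight zero, so
  \<open>\<gamma>\<^sub>v\<close> stays near the line of direction \<open>u\<close> as well, and \<open>u = v\<close>. For the orbits, translate
  \<open>\<gamma>\<^sub>u\<close> by \<open>y\<^bsup>2d\<^esup>\<close>: each horizontal edge now has weight at least two. A path from there to
  \<open>\<gamma>\<^sub>u\<close> must compensate the accumulated weight by inverse letters, and a bounded number of
  them can only make up for a bounded amount, so the Busemann function changes unboundedly along the translated ray.\<close>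

section \<open>Words and group elements\<close>

abbreviation elt :: "word \<Rightarrow> cartan" where "elt \<equiv> abs_cartan"

abbreviation clen :: "word \<Rightarrow> nat" where
  "clen w \<equiv> word_length cartan_group cartan_gens (elt w)"

lemma elt_eq_iff: "elt v = elt w \<longleftrightarrow> cartan_eq v w"
  by (rule cartan.abs_eq_iff)

lemma elt_mult [simp]: "elt v \<otimes>\<^bsub>cartan_group\<^esub> elt w = elt (v @ w)"
  by (simp add: cartan_group_def cartan_mult.abs_eq)

lemma elt_one: "\<one>\<^bsub>cartan_group\<^esub> = elt []"
  by (simp add: cartan_group_def cartan_one.abs_eq)

lemma carrier_cartan_group [simp]: "carrier cartan_group = UNIV"
  by (simp add: cartan_group_def)

lemma elt_cases: obtains w where "g = elt w"
  by (induction g rule: cartan.abs_induct) blast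

lemma elt_cancel_inv [simp]:
  "elt (word_inv w @ w) = elt []" "elt (w @ word_inv w) = elt []"
  by (simp_all add: elt_eq_iff cartan_eq_word_inv_left cartan_eq.cancel)

lemma elt_inv [simp]: "inv\<^bsub>cartan_group\<^esub> elt w = elt (word_inv w)"
  by (rule group.inv_equality[OF group_cartan_group]) (simp_all add: elt_one)

lemma elt_append_cong: "elt v = elt v' \<Longrightarrow> elt w = elt w' \<Longrightarrow> elt (v @ w) = elt (v' @ w')"
  by (simp add: elt_eq_iff cartan_eq.append)

lemma elt_cancel_mid:
  "elt (u @ word_inv w @ w @ v) = elt (u @ v)" "elt (u @ w @ word_inv w @ v) = elt (u @ v)"
  by (metis append_Nil append_assoc elt_append_cong elt_cancel_inv(1))
    (metis append_Nil append_assoc elt_append_cong elt_cancel_inv(2))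

lemma length_word_inv [simp]: "length (word_inv w) = length w"
  by (simp add: word_inv_def)

lemma cartan_gens_eq: "cartan_gens = range (\<lambda>l. elt [l])"
proof -
  have "word_inv [(s, False)] = [(s, True)]" for s by (simp add: word_inv_def)
  then have "cartan_gens = {elt [(X, False)], elt [(X, True)], elt [(Y, False)], elt [(Y, True)]}"
    unfolding cartan_gens_def cartan_gen.abs_eq elt_inv by simp
  also have "\<dots> = range (\<lambda>l. elt [l])"
  proof (intro equalityI subsetI)
    fix g assume "g \<in> range (\<lambda>l. elt [l])"
    then obtain s e where "g = elt [(s, e)]" by auto
    then show "g \<in> {elt [(X, False)], elt [(X, True)], elt [(Y, False)], elt [(Y, True)]}"
      by (cases s; cases e) auto
  qed auto
  finally show ?thesis .
qed

lemma word_length_words: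
  "word_length cartan_group cartan_gens g = (LEAST n. \<exists>w. length w = n \<and> elt w = g)"
proof -
  have fold: "foldr (\<lambda>a b. a \<otimes>\<^bsub>cartan_group\<^esub> b) (map (\<lambda>l. elt [l]) w) \<one>\<^bsub>cartan_group\<^esub> = elt w" for w
    by (induction w) (simp_all add: elt_one)
  have "(\<exists>ws. length ws = n \<and> set ws \<subseteq> cartan_gens \<and>
      foldr (\<lambda>a b. a \<otimes>\<^bsub>cartan_group\<^esub> b) ws \<one>\<^bsub>cartan_group\<^esub> = g) \<longleftrightarrow> (\<exists>w. length w = n \<and> elt w = g)" for n
  proof
    assume "\<exists>ws. length ws = n \<and> set ws \<subseteq> cartan_gens \<and>
      foldr (\<lambda>a b. a \<otimes>\<^bsub>cartan_group\<^esub> b) ws \<one>\<^bsub>cartan_group\<^esub> = g"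
    then obtain ws where ws: "length ws = n" "set ws \<subseteq> cartan_gens"
      "foldr (\<lambda>a b. a \<otimes>\<^bsub>cartan_group\<^esub> b) ws \<one>\<^bsub>cartan_group\<^esub> = g" by blast
    from ws(2) have "\<forall>g\<in>set ws. \<exists>l. g = elt [l]"
      unfolding cartan_gens_eq by blast
    then obtain w where "ws = map (\<lambda>l. elt [l]) w"
      unfolding ex_map_conv[symmetric] by blast
    with ws fold show "\<exists>w. length w = n \<and> elt w = g" by auto
  next
    assume "\<exists>w. length w = n \<and> elt w = g"
    then obtain w where "length w = n" "elt w = g" by blast
    then show "\<exists>ws. length ws = n \<and> set ws \<subseteq> cartan_gens \<and>
      foldr (\<lambda>a b. a \<otimes>\<^bsub>cartan_group\<^esub> b) ws \<one>\<^bsub>cartan_group\<^esub> = g"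
      using fold by (intro exI[of _ "map (\<lambda>l. elt [l]) w"]) (auto simp: cartan_gens_eq)
  qed
  then show ?thesis unfolding word_length_def by simp
qed

lemma clen_le: "clen w \<le> length w"
  unfolding word_length_words by (rule Least_le) blast

lemma clen_attained: obtains v where "length v = clen w" "elt v = elt w"
proof -
  have "\<exists>v. length v = (LEAST n. \<exists>v. length v = n \<and> elt v = elt w) \<and> elt v = elt w"
    by (rule LeastI[of _ "length w"]) blast
  then show ?thesis using that unfolding word_length_words by blast
qed

lemma clen_append: "clen (v @ w) \<le> clen v + clen w"
proof -
  obtain v' where "length v' = clen v" "elt v' = elt v" by (rule clen_attained)
  moreover obtain w' where "length w' = clen w" "elt w' = elt w" by (rule clen_attained)
  ultimately show ?thesis using clen_le[of "v' @ w'"] elt_append_cong[of v' v w' w] by simp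
qed

lemma clen_word_inv [simp]: "clen (word_inv w) = clen w"
proof -
  have "clen (word_inv w) \<le> clen w" for w
  proof -
    obtain v where v: "length v = clen w" "elt v = elt w" by (rule clen_attained)
    then have "elt (word_inv v) = elt (word_inv w)" by (metis elt_inv)
    with v clen_le[of "word_inv v"] show ?thesis by simp
  qed
  from this[of w] this[of "word_inv w"] show ?thesis by simp
qed

lemma word_dist_elt: "word_dist cartan_group cartan_gens (elt v) (elt w) = clen (word_inv v @ w)"
  by (simp add: word_dist_def)

lemma word_dist_commute:
  "word_dist cartan_group cartan_gens g h = word_dist cartan_group cartan_gens h g"
proof -
  obtain v w where "g = elt v" "h = elt w" using elt_cases by metis
  then show ?thesis using clen_word_inv[of "word_inv v @ w"]
    by (simp add: word_dist_elt word_inv_append)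
qed

lemma word_dist_triangle:
  "word_dist cartan_group cartan_gens f h
    \<le> word_dist cartan_group cartan_gens f g + word_dist cartan_group cartan_gens g h"
proof -
  obtain u v w where [simp]: "f = elt u" "g = elt v" "h = elt w" using elt_cases by metis
  have "elt (word_inv u @ w) = elt ((word_inv u @ v) @ (word_inv v @ w))"
    by (simp add: elt_cancel_mid)
  then show ?thesis
    using clen_append[of "word_inv u @ v" "word_inv v @ w"] by (simp add: word_dist_elt)
qed

lemma word_dist_path:
  obtains v where "length v = word_dist cartan_group cartan_gens g h"
    "g \<otimes>\<^bsub>cartan_group\<^esub> elt v = h"
proof -
  obtain a b where [simp]: "g = elt a" "h = elt b" using elt_cases by metis
  obtain v where "length v = clen (word_inv a @ b)" "elt v = elt (word_inv a @ b)"
    by (rule clen_attained)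
  moreover from this have "elt (a @ v) = elt b"
    using elt_append_cong[of a a v "word_inv a @ b"] elt_cancel_mid(2)[of "[]" a b] by simp
  ultimately show ?thesis using that by (simp add: word_dist_elt)
qed


section \<open>Busemann functions of geodesic rays\<close>

locale geodesic_word_ray =
  fixes l :: "nat \<Rightarrow> gen \<times> bool"
  assumes geodesic: "clen (map l [0..<n]) = n"
begin

abbreviation ray :: "nat \<Rightarrow> cartan" where "ray n \<equiv> elt (map l [0..<n])"

abbreviation bus :: "cartan \<Rightarrow> real" where "bus \<equiv> busemann cartan_group cartan_gens ray"

lemma word_dist_one: "word_dist cartan_group cartan_gens (ray n) \<one>\<^bsub>cartan_group\<^esub> = n"
  using word_dist_elt[of "map l [0..<n]" "[]"] geodesic by (simp add: elt_one)

lemma word_dist_ray: "m \<le> n \<Longrightarrow> word_dist cartan_group cartan_gens (ray n) (ray m) = n - m"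
proof (rule antisym)
  assume mn: "m \<le> n"
  have "map l [0..<n] = map l [0..<m] @ map l [m..<n]"
    using upt_add_eq_append[of 0 m "n - m"] mn by (simp flip: map_append)
  then have "elt (word_inv (map l [0..<m]) @ map l [0..<n]) = elt (map l [m..<n])"
    using elt_cancel_mid(1)[of "[]" "map l [0..<m]" "map l [m..<n]"] by (simp only: append_Nil)
  then have "word_dist cartan_group cartan_gens (ray m) (ray n) \<le> n - m"
    using clen_le[of "map l [m..<n]"] by (simp add: word_dist_elt)
  then show "word_dist cartan_group cartan_gens (ray n) (ray m) \<le> n - m"
    by (simp add: word_dist_commute)
  show "n - m \<le> word_dist cartan_group cartan_gens (ray n) (ray m)"
    using word_dist_triangle[of "ray n" "\<one>\<^bsub>cartan_group\<^esub>" "ray m"] by (simp add: word_dist_one)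
qed

text \<open>Along a geodesic ray the distance from \<open>ray n\<close> to \<open>h\<close> minus
  \<open>n\<close> is a nonincreasing integer sequence, bounded below by the triangle inequality. It
  is eventually constant, so the limit is attained.\<close>

lemma eventually_bus:
  "\<forall>\<^sub>F n in sequentially. horo_embed cartan_group cartan_gens (ray n) h = bus h"
proof -
  let ?d = "\<lambda>n. word_dist cartan_group cartan_gens (ray n) h"
  let ?c = "word_dist cartan_group cartan_gens h \<one>\<^bsub>cartan_group\<^esub>"
  \<comment> \<open>By the triangle inequality the truncated subtraction loses nothing.\<close>
  define f where "f n = ?d n + ?c - n" for n
  have f: "f n + n = ?d n + ?c" for n
    using word_dist_triangle[of "ray n" "\<one>\<^bsub>cartan_group\<^esub>" h] by (simp add: word_dist_one f_def)
  have step: "?d (Suc n) \<le> ?d n + 1" for n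
    using word_dist_triangle[of "ray (Suc n)" h "ray n"] word_dist_ray[of n "Suc n"] by simp
  have "f (Suc n) \<le> f n" for n
    using f[of n] f[of "Suc n"] step[of n] by linarith
  then have dec: "f n \<le> f m" if "m \<le> n" for m n
    using that by (rule lift_Suc_antimono_le)
  obtain N where N: "\<And>n. f N \<le> f n"
    using ex_has_least_nat[of "\<lambda>_. True" 0 f] by auto
  then have const: "f n = f N" if "n \<ge> N" for n using dec[OF that] by (simp add: antisym)
  have "horo_embed cartan_group cartan_gens (ray n) h = real (f N) - real ?c" if "n \<ge> N" for n
    using const[OF that] f[of n] by (simp add: horo_embed_def word_dist_one)
  then have ev: "\<forall>\<^sub>F n in sequentially.
      horo_embed cartan_group cartan_gens (ray n) h = real (f N) - real ?c"
    using eventually_sequentially by auto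
  then have "(\<lambda>n. horo_embed cartan_group cartan_gens (ray n) h) \<longlonglongrightarrow> real (f N) - real ?c"
    by (rule tendsto_eventually)
  then have "bus h = real (f N) - real ?c"
    by (simp add: busemann_def limI)
  with ev show ?thesis by simp
qed

text \<open>A shortest word from \<open>h\<close> to a far ray point has length
  \<open>n + bus h\<close>. This turns values of the Busemann function into words, with
  \<open>n\<close> as large as desired.\<close>

lemma bus_path:
  obtains n v where "n \<ge> N" "real (length v) = real n + bus h"
    "h \<otimes>\<^bsub>cartan_group\<^esub> elt v = ray n"
proof -
  have "\<forall>\<^sub>F n in sequentially. n \<ge> N \<and> horo_embed cartan_group cartan_gens (ray n) h = bus h"
    by (intro eventually_conj eventually_ge_at_top eventually_bus)
  then obtain n where n: "n \<ge> N" "horo_embed cartan_group cartan_gens (ray n) h = bus h"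
    using eventually_happens'[OF sequentially_bot] by blast
  obtain v where v: "length v = word_dist cartan_group cartan_gens h (ray n)"
    "h \<otimes>\<^bsub>cartan_group\<^esub> elt v = ray n" by (rule word_dist_path)
  show ?thesis
  proof (rule that)
    show "real (length v) = real n + bus h"
      using v n(2) word_dist_commute[of h] by (simp add: horo_embed_def word_dist_one)
  qed (use v n in auto)
qed

lemma bus_ray [simp]: "bus (ray m) = - real m"
proof -
  have "\<forall>\<^sub>F n in sequentially. n \<ge> m \<and> horo_embed cartan_group cartan_gens (ray n) (ray m) = bus (ray m)"
    by (intro eventually_conj eventually_ge_at_top eventually_bus)
  then obtain n where "n \<ge> m" "horo_embed cartan_group cartan_gens (ray n) (ray m) = bus (ray m)"
    using eventually_happens'[OF sequentially_bot] by blast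
  then show ?thesis by (simp add: horo_embed_def word_dist_one word_dist_ray)
qed

text \<open>The ray converges to \<open>bus\<close> pointwise. Along the ray \<open>bus\<close> is
  unbounded below, while the function of a group element is bounded below by minus its distance to
  the identity.\<close>

lemma bus_in_horoboundary: "bus \<in> horoboundary cartan_group cartan_gens"
proof -
  have "limitin (product_topology (\<lambda>_. euclideanreal) (carrier cartan_group))
      (\<lambda>n. horo_embed cartan_group cartan_gens (ray n)) bus sequentially"
    unfolding limitin_componentwise
    by (auto simp: horo_embed_def busemann_def extensional_def intro!: tendsto_eventually)
      (use eventually_bus in \<open>simp add: horo_embed_def busemann_def\<close>)
  then have "bus \<in> (product_topology (\<lambda>_. euclideanreal) (carrier cartan_group)) closure_of
      (horo_embed cartan_group cartan_gens ` carrier cartan_group)"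
    unfolding limitin_def in_closure_of
    by (auto dest!: eventually_happens'[OF sequentially_bot])
  moreover have "bus \<noteq> horo_embed cartan_group cartan_gens g" for g
  proof
    assume eq: "bus = horo_embed cartan_group cartan_gens g"
    define m where "m = Suc (word_dist cartan_group cartan_gens g \<one>\<^bsub>cartan_group\<^esub>)"
    have "bus (ray m) = horo_embed cartan_group cartan_gens g (ray m)" using eq by metis
    then have "- real m = horo_embed cartan_group cartan_gens g (ray m)" by (simp only: bus_ray)
    moreover have "real m = real (word_dist cartan_group cartan_gens g \<one>\<^bsub>cartan_group\<^esub>) + 1"
      by (simp add: m_def)
    ultimately show False by (simp add: horo_embed_def)
  qed
  ultimately show ?thesis unfolding horoboundary_def by blast
qed

end

section \<open>Weighted edge counts of lattice paths\<close>

text \<open>A discrete integral of \<open>g dx\<close>. An edge is named by its left end, hence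
  \<open>i - 1\<close> for an inverse horizontal letter, which traverses its edge backwards.\<close>

fun edge_weight :: "(int \<Rightarrow> int \<Rightarrow> real) \<Rightarrow> int \<times> int \<Rightarrow> gen \<times> bool \<Rightarrow> real" where
  "edge_weight g (i, j) (X, e) = (if e then - g (i - 1) j else g i j)"
| "edge_weight g (i, j) (Y, e) = 0"

primrec edge_sum :: "(int \<Rightarrow> int \<Rightarrow> real) \<Rightarrow> int \<times> int \<Rightarrow> word \<Rightarrow> real" where
  "edge_sum g p [] = 0"
| "edge_sum g p (l # w) = edge_weight g p l + edge_sum g (p + letter_ab l) w"

lemma word_ab_simps [simp]: "word_ab [] = 0" "word_ab (l # w) = letter_ab l + word_ab w"
  by (simp_all add: word_ab_def)

lemma edge_sum_append:
  "edge_sum g p (v @ w) = edge_sum g p v + edge_sum g (p + word_ab v) w"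
  by (induction v arbitrary: p) (simp_all add: add.assoc)

lemma edge_sum_word_inv: "edge_sum g p (word_inv w) = - edge_sum g (p - word_ab w) w"
proof (induction w arbitrary: p)
  case Nil
  show ?case by (simp add: word_inv_def)
next
  case (Cons l w)
  obtain s e where l: "l = (s, e)" by (cases l)
  have inv: "word_inv (l # w) = word_inv w @ [(s, \<not> e)]" by (simp add: word_inv_def l)
  obtain i j where p: "p - word_ab w = (i, j)" by force
  have "edge_weight g (i, j) (s, \<not> e) = - edge_weight g ((i, j) - letter_ab (s, e)) (s, e)"
    by (cases s) auto
  then have "edge_weight g (p - word_ab w) (s, \<not> e)
      = - edge_weight g (p - (letter_ab (s, e) + word_ab w)) (s, e)"
    by (simp only: p[symmetric]) (simp add: algebra_simps)
  then show ?case
    unfolding inv edge_sum_append using Cons by (simp add: l algebra_simps)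
qed

lemma edge_sum_minus:
  "edge_sum (\<lambda>i j. g i j - h i j) p w = edge_sum g p w - edge_sum h p w"
proof (induction w arbitrary: p)
  case (Cons l w)
  obtain s e i j where "l = (s, e)" "p = (i, j)" by force
  then show ?case using Cons by (cases s) simp_all
qed simp

definition invariant_weight :: "(int \<Rightarrow> int \<Rightarrow> real) \<Rightarrow> bool" where
  "invariant_weight g \<longleftrightarrow>
    (\<forall>a b c d p. edge_sum g p (word_comm (word_comm (word_comm a b) c) d) = 0)"

lemma word_ab_word_comm [simp]: "word_ab (word_comm a b) = 0"
  by (simp add: word_comm_def)

text \<open>Around a commutator each word is traversed once in each direction, from different base
  points. Each bracket is thus a finite difference of a count, which lowers its degree in the base
  point.\<close>

lemma edge_sum_word_comm:
  "edge_sum g p (word_comm a b) =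
    (edge_sum g (p - word_ab b) b - edge_sum g (p - word_ab a - word_ab b) b)
    - (edge_sum g (p - word_ab a) a - edge_sum g (p - word_ab a - word_ab b) a)"
  by (simp add: word_comm_def edge_sum_append edge_sum_word_inv algebra_simps)

lemma edge_sum_cartan_eq:
  assumes "invariant_weight g" "cartan_eq v w"
  shows "edge_sum g p v = edge_sum g p w"
proof -
  \<comment> \<open>The displacement and all base points enter the induction because in
    \<open>append\<close> the second factor starts where the first one ends.\<close>
  have "word_ab v = word_ab w \<and> (\<forall>p. edge_sum g p v = edge_sum g p w)"
    using assms(2)
  proof induction
    case (nilpotent a b c d)
    then show ?case using assms(1) by (simp add: invariant_weight_def)
  qed (simp_all add: edge_sum_append edge_sum_word_inv del: split_paired_All)
  then show ?thesis by blast
qed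

lemma invariant_weight_minus:
  "invariant_weight g \<Longrightarrow> invariant_weight h \<Longrightarrow> invariant_weight (\<lambda>i j. g i j - h i j)"
  by (simp add: invariant_weight_def edge_sum_minus)

text \<open>Such a weight has a primitive \<open>F\<close>, so its counts telescope to a function of
  the end points, and a commutator is a closed path.\<close>

lemma invariant_weight_column: "invariant_weight (\<lambda>i j. f i)"
proof -
  define F where "F i = sum f {0..<i} - sum f {i..<0}" for i :: int
  have F: "F (i + 1) = F i + f i" for i
  proof (cases "i \<ge> 0")
    case True
    then have "{0..<i + 1} = insert i {0..<i}" by auto
    with True show ?thesis by (simp add: F_def)
  next
    case False
    then have "{i..<0} = insert i {i + 1..<0}" by auto
    with False show ?thesis by (simp add: F_def)
  qed
  have "edge_sum (\<lambda>i j. f i) p w = F (fst p + fst (word_ab w)) - F (fst p)" for p w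
  proof (induction w arbitrary: p)
    case (Cons l w)
    obtain s e i j where "l = (s, e)" "p = (i, j)" by force
    then show ?case using F[of i] F[of "i - 1"] by (cases s) (simp_all add: Cons.IH add_ac)
  qed simp
  then show ?thesis by (simp add: invariant_weight_def)
qed

text \<open>As a function of the base point, the edge count of a word for these weights is a polynomial
  of degree two; every commutator lowers the degree.\<close>

lemma invariant_weight_quadratic:
  "invariant_weight (\<lambda>i j. (real_of_int j)\<^sup>2 + k * (real_of_int i + 1/2) * real_of_int j)"
proof -
  define g where "g i j = (real_of_int j)\<^sup>2 + k * (real_of_int i + 1/2) * real_of_int j" for i j
  \<comment> \<open>No term in \<open>i\<^sup>2\<close> arises: shifting the base point by a unit
    step and adding the weight of an edge preserves the span of these monomials.\<close>
  have word: "\<exists>a0 a1 a2 a3 a4. \<forall>i j. edge_sum g (i, j) w =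
      a0 + a1 * i + a2 * j + a3 * (real_of_int j)\<^sup>2 + a4 * real_of_int i * j" for w
  proof (induction w)
    case Nil
    show ?case by (intro exI[of _ 0]) simp
  next
    case (Cons l w)
    then obtain a0 a1 a2 a3 a4 where IH: "\<And>i j. edge_sum g (i, j) w =
      a0 + a1 * i + a2 * j + a3 * (real_of_int j)\<^sup>2 + a4 * real_of_int i * j" by blast
    obtain s e where l: "l = (s, e)" by (cases l)
    consider "l = (X, False)" | "l = (X, True)" | "l = (Y, False)" | "l = (Y, True)"
      using l by (cases s; cases e) auto
    then show ?case
    proof cases
      case 1
      show ?thesis unfolding 1
        by (rule exI[of _ "a0 + a1"], rule exI[of _ "a1"], rule exI[of _ "a2 + a4 + k/2"], rule exI[of _ "a3 + 1"], rule exI[of _ "a4 + k"],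
           simp add: IH, simp add: g_def power2_eq_square algebra_simps)
    next
      case 2
      show ?thesis unfolding 2
        by (rule exI[of _ "a0 - a1"], rule exI[of _ "a1"], rule exI[of _ "a2 - a4 + k/2"], rule exI[of _ "a3 - 1"], rule exI[of _ "a4 - k"],
           simp add: IH, simp add: g_def power2_eq_square algebra_simps)
    next
      case 3
      show ?thesis unfolding 3
        by (rule exI[of _ "a0 + a2 + a3"], rule exI[of _ "a1 + a4"], rule exI[of _ "a2 + 2 * a3"], rule exI[of _ a3], rule exI[of _ a4],
           simp add: IH, simp add: g_def power2_eq_square algebra_simps)
    next
      case 4
      show ?thesis unfolding 4
        by (rule exI[of _ "a0 - a2 + a3"], rule exI[of _ "a1 - a4"], rule exI[of _ "a2 - 2 * a3"], rule exI[of _ a3], rule exI[of _ a4],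
           simp add: IH, simp add: g_def power2_eq_square algebra_simps)
    qed
  qed
  have comm1: "\<exists>a0 a1 a2. \<forall>i j. edge_sum g (i, j) (word_comm v w) =
      a0 + a1 * real_of_int i + a2 * real_of_int j" for v w
  proof -
    obtain a0 a1 a2 a3 a4 where v: "\<And>i j. edge_sum g (i, j) v =
      a0 + a1 * i + a2 * j + a3 * (real_of_int j)\<^sup>2 + a4 * real_of_int i * j" using word by blast
    obtain b0 b1 b2 b3 b4 where w: "\<And>i j. edge_sum g (i, j) w =
      b0 + b1 * i + b2 * j + b3 * (real_of_int j)\<^sup>2 + b4 * real_of_int i * j" using word by blast
    obtain m n m' n' where ab: "word_ab v = (m, n)" "word_ab w = (m', n')" by force
    define D where "D i j = edge_sum g (i, j) (word_comm v w)" for i j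
    have D: "D i j =
        (b1 * m + b2 * n + b3 * ((2 * j - 2 * n' - n) * n) + b4 * (m * j + i * n - m * n' - n * m' - m * n))
      - (a1 * m' + a2 * n' + a3 * ((2 * j - 2 * n - n') * n') + a4 * (m' * j + i * n' - m * n' - n * m' - m' * n'))"
      for i j
      unfolding D_def edge_sum_word_comm ab
      by (simp add: v w power2_eq_square algebra_simps)
    show ?thesis
      by (rule exI[of _ "D 0 0"], rule exI[of _ "D 1 0 - D 0 0"], rule exI[of _ "D 0 1 - D 0 0"], intro allI)
         (simp only: D_def[symmetric], simp add: D algebra_simps)
  qed
  have comm2: "\<exists>a0. \<forall>p. edge_sum g p (word_comm (word_comm a b) c) = a0" for a b c
  proof -
    obtain a0 a1 a2 where v: "\<And>i j. edge_sum g (i, j) (word_comm a b) =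
      a0 + a1 * real_of_int i + a2 * real_of_int j" using comm1 by blast
    obtain m n where ab: "word_ab c = (m, n)" by force
    have "edge_sum g (i, j) (word_comm (word_comm a b) c) = - a1 * m - a2 * n" for i j
      by (subst edge_sum_word_comm) (simp add: ab v algebra_simps)
    then show ?thesis by (intro exI[of _ "- a1 * m - a2 * n"]) auto
  qed
  have "edge_sum g p (word_comm (word_comm (word_comm a b) c) d) = 0" for a b c d p
  proof -
    obtain a0 where "\<And>p. edge_sum g p (word_comm (word_comm a b) c) = a0" using comm2 by blast
    then show ?thesis by (subst edge_sum_word_comm) simp
  qed
  then have "invariant_weight g" unfolding invariant_weight_def by blast
  then show ?thesis by (simp only: g_def[abs_def])
qed

section \<open>The staircase weight\<close>

text \<open>For integer \<open>j\<close> this is nonnegative, and it vanishes iff the horizontal edge from \<open>(i, j)\<close> to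
  \<open>(i + 1, j)\<close> is, among the edges of its column, nearest to the line of slope \<open>s\<close>. The subtracted term depends
  on \<open>i\<close> only, so that its edge counts are determined by the end points.\<close>

definition stair :: "real \<Rightarrow> int \<Rightarrow> int \<Rightarrow> real" where
  "stair s i j = (real_of_int j - s * (real_of_int i + 1/2))\<^sup>2
    - (s * (real_of_int i + 1/2) - of_int (round (s * (real_of_int i + 1/2))))\<^sup>2"

lemma invariant_weight_stair: "invariant_weight (stair s)"
proof -
  let ?q = "\<lambda>i j. (real_of_int j)\<^sup>2 + (- 2 * s) * (real_of_int i + 1/2) * real_of_int j"
  let ?c = "\<lambda>i. (s * (real_of_int i + 1/2) - of_int (round (s * (real_of_int i + 1/2))))\<^sup>2
    - (s * (real_of_int i + 1/2))\<^sup>2"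
  have "stair s = (\<lambda>i j. ?q i j - ?c i)"
    by (intro ext) (simp add: stair_def power2_eq_square algebra_simps)
  then show ?thesis
    using invariant_weight_minus[OF invariant_weight_quadratic[of "- 2 * s"] invariant_weight_column[of ?c]]
    by simp
qed

lemma stair_nonneg: "stair s i j \<ge> 0"
proof -
  let ?x = "s * (real_of_int i + 1/2)"
  have "\<bar>?x - of_int (round ?x)\<bar> \<le> \<bar>?x - of_int j\<bar>" by (rule round_diff_minimal)
  then show ?thesis unfolding stair_def by (simp add: abs_le_square_iff power2_commute)
qed

lemma round_defect_le: "(x - of_int (round x))\<^sup>2 \<le> 1/4" for x :: real
proof -
  have "\<bar>x - of_int (round x)\<bar> \<le> 1/2" using of_int_round_abs_le[of x] by (simp add: abs_minus_commute)
  then show ?thesis using abs_le_square_iff[of "x - of_int (round x)" "1/2"]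
    by (simp add: power2_eq_square)
qed

lemma stair_eq_0_iff: "stair s i j = 0 \<longleftrightarrow> \<bar>real_of_int j - s * (real_of_int i + 1/2)\<bar> \<le> 1/2"
proof
  let ?x = "s * (real_of_int i + 1/2)"
  assume "stair s i j = 0"
  then have "(real_of_int j - ?x)\<^sup>2 \<le> (1/2)\<^sup>2"
    using round_defect_le[of ?x] by (simp add: stair_def power2_eq_square)
  then show "\<bar>real_of_int j - ?x\<bar> \<le> 1/2" by (simp flip: abs_le_square_iff)
next
  let ?x = "s * (real_of_int i + 1/2)"
  assume near: "\<bar>real_of_int j - ?x\<bar> \<le> 1/2"
  show "stair s i j = 0"
  proof (cases "round ?x = j")
    case True
    then show ?thesis by (simp add: stair_def power2_commute)
  next
    \<comment> \<open>If \<open>j\<close> is not the rounded value, both must be at distance exactly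
      1/2. Such ties occur where a square is centred on the line.\<close>
    case False
    have "\<bar>?x - of_int (round ?x)\<bar> \<le> 1/2"
      using of_int_round_abs_le[of ?x] by (simp add: abs_minus_commute)
    moreover have "\<bar>real_of_int (round ?x) - real_of_int j\<bar> \<ge> 1"
      using False by linarith
    ultimately have "\<bar>?x - of_int (round ?x)\<bar> = 1/2" "\<bar>real_of_int j - ?x\<bar> = 1/2"
      using near by linarith+
    then have "(?x - of_int (round ?x))\<^sup>2 = (1/2)\<^sup>2" "(real_of_int j - ?x)\<^sup>2 = (1/2)\<^sup>2"
      by (metis power2_abs)+
    then show ?thesis by (simp add: stair_def)
  qed
qed

section \<open>Deviation from the line and the size of the weight\<close>

definition dev :: "real \<Rightarrow> int \<times> int \<Rightarrow> real" where
  "dev s p = real_of_int (snd p) - s * real_of_int (fst p)"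

lemma dev_add: "dev s (p + q) = dev s p + dev s q"
  by (simp add: dev_def algebra_simps)

text \<open>The midpoint of the edge has deviation \<open>dev s (i, j) - s/2\<close>. For
  \<open>w \<ge> 0\<close> one has \<open>(w + 1/2)\<^sup>2 \<ge> w\<^sup>2 + 1/4\<close>, and the
  1/4 pays for the subtracted rounding defect.\<close>

lemma stair_ge: "stair s i j \<ge> (max 0 (\<bar>dev s (i, j) - s/2\<bar> - 1/2))\<^sup>2"
proof (cases "\<bar>dev s (i, j) - s/2\<bar> \<le> 1/2")
  case True
  then show ?thesis using stair_nonneg by simp
next
  case False
  define w where "w = \<bar>dev s (i, j) - s/2\<bar> - 1/2"
  have "(real_of_int j - s * (real_of_int i + 1/2))\<^sup>2 = (w + 1/2)\<^sup>2"
    unfolding w_def dev_def by (simp add: algebra_simps)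
  moreover have "(w + 1/2)\<^sup>2 \<ge> w\<^sup>2 + 1/4"
    using False by (simp add: w_def power2_eq_square algebra_simps)
  ultimately have "stair s i j \<ge> w\<^sup>2"
    using round_defect_le[of "s * (real_of_int i + 1/2)"] by (simp add: stair_def)
  then show ?thesis using False by (simp add: w_def)
qed

lemma stair_le:
  assumes "\<bar>dev s (i, j) - s/2\<bar> \<le> B"
  shows "stair s i j \<le> B\<^sup>2"
proof -
  have "(real_of_int j - s * (real_of_int i + 1/2))\<^sup>2 = (dev s (i, j) - s/2)\<^sup>2"
    by (simp add: dev_def algebra_simps)
  also have "\<dots> \<le> B\<^sup>2" using assms by (metis abs_ge_zero power2_abs power_mono)
  finally show ?thesis unfolding stair_def by (smt (verit) zero_le_power2)
qed

section \<open>Potential estimates for words with inverse letters\<close>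

definition inv_count :: "word \<Rightarrow> nat" where "inv_count w = length (filter snd w)"

lemma inv_count_simps [simp]:
  "inv_count [] = 0" "inv_count (l # w) = (if snd l then Suc (inv_count w) else inv_count w)"
  "inv_count (v @ w) = inv_count v + inv_count w"
  by (simp_all add: inv_count_def)

text \<open>Positive letters raise the coordinate sum by one and inverse letters lower it by one, so
  length and displacement determine the number of inverse letters.\<close>

lemma word_ab_sum: "fst (word_ab w) + snd (word_ab w) = int (length w) - 2 * int (inv_count w)"
proof (induction w)
  case (Cons l w)
  obtain s e where "l = (s, e)" by force
  with Cons show ?case by (cases s) auto
qed simp

text \<open>Telescoping of \<open>H\<close> along the path. Each inverse letter may fall short by
  \<open>c\<close>; \<open>P\<close> confines the path to where the estimate for a single step is
  available.\<close>

lemma edge_sum_potential: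
  assumes step: "\<And>q l. P q \<Longrightarrow>
      H q - H (q + letter_ab l) - (if snd l then c else 0) \<le> k * edge_weight g q l"
    and "\<And>n. P (p + word_ab (take n v))"
  shows "H p - H (p + word_ab v) - c * inv_count v \<le> k * edge_sum g p v"
  using assms(2)
proof (induction v arbitrary: p)
  case (Cons l v)
  have "P p" using Cons.prems[of 0] by simp
  then have "H p - H (p + letter_ab l) - (if snd l then c else 0) \<le> k * edge_weight g p l"
    by (rule step)
  moreover have "P (p + letter_ab l + word_ab (take n v))" for n
    using Cons.prems[of "Suc n"] by (simp add: add.assoc)
  then have "H (p + letter_ab l) - H (p + letter_ab l + word_ab v) - c * inv_count v
      \<le> k * edge_sum g (p + letter_ab l) v"
    by (rule Cons.IH)
  ultimately show ?case by (cases "snd l") (simp_all add: algebra_simps)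
qed simp

text \<open>The potential of a deviation \<open>t\<close> from the line: crossing it with positive letters costs about
  \<open>\<integral> t\<^sup>2 dt\<close>. The shift makes the comparison exact for the discrete sum.\<close>

definition cubic :: "real \<Rightarrow> real \<Rightarrow> real" where
  "cubic s t = (max 0 (t - (s + 1)/2)) ^ 3 / 3"

lemma cubic_mono: "t \<le> t' \<Longrightarrow> cubic s t \<le> cubic s t'"
  unfolding cubic_def by (intro divide_right_mono power_mono) auto

lemma cubic_diff:
  assumes "d \<ge> 0"
  shows "cubic s (t + d) - cubic s t \<le> d * (max 0 (t + d - (s + 1)/2))\<^sup>2"
proof -
  define a b where "a = max 0 (t - (s + 1)/2)" and "b = max 0 (t + d - (s + 1)/2)"
  have ab: "0 \<le> a" "a \<le> b" "b - a \<le> d" using assms by (auto simp: a_def b_def)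
  have "b ^ 3 - a ^ 3 = (b - a) * (b\<^sup>2 + a * b + a\<^sup>2)"
    by (simp add: power2_eq_square power3_eq_cube algebra_simps)
  also have "\<dots> \<le> d * (b\<^sup>2 + b * b + b\<^sup>2)"
    using ab by (intro mult_mono add_mono power_mono) auto
  finally show ?thesis by (simp add: cubic_def flip: a_def b_def) (simp add: power2_eq_square)
qed

context
  fixes s M c :: real
  assumes s: "s \<ge> 0"
  defines "c \<equiv> (1 + s) * (M + s + 1)\<^sup>2"
begin

text \<open>\<open>c\<close> bounds what one inverse letter can gain where the deviation is at most
  \<open>M\<close>; its factor \<open>1 + s\<close> covers both weights and weights multiplied by
  \<open>s\<close>.\<close>

lemma cost_bounds:
  assumes "\<bar>t\<bar> \<le> M" "\<bar>y\<bar> \<le> \<bar>t\<bar> + s + 1"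
  shows "y\<^sup>2 \<le> c" "s * y\<^sup>2 \<le> c"
proof -
  have "y\<^sup>2 \<le> (M + s + 1)\<^sup>2"
    using assms power_mono[of "\<bar>y\<bar>" "M + s + 1" 2] by simp
  then have "s * y\<^sup>2 \<le> s * (M + s + 1)\<^sup>2" "y\<^sup>2 \<le> (M + s + 1)\<^sup>2" using s by (auto intro: mult_left_mono)
  moreover have "c = (M + s + 1)\<^sup>2 + s * (M + s + 1)\<^sup>2" "0 \<le> (M + s + 1)\<^sup>2"
    by (simp_all add: c_def algebra_simps)
  moreover have "0 \<le> s * (M + s + 1)\<^sup>2" using s by simp
  ultimately show "y\<^sup>2 \<le> c" "s * y\<^sup>2 \<le> c" by linarith+
qed

text \<open>Only an inverse horizontal letter can have negative weight, and the left end of its edge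
  has deviation larger by \<open>s\<close>.\<close>

lemma weight_lower:
  assumes "\<bar>dev s q\<bar> \<le> M"
  shows "- (if snd l then c else 0) \<le> edge_weight (stair s) q l"
    and "- (if snd l then c else 0) \<le> s * edge_weight (stair s) q l"
proof -
  obtain x e i j where [simp]: "l = (x, e)" "q = (i, j)" by force
  have "dev s (i - 1, j) = dev s (i, j) + s" by (simp add: dev_def algebra_simps)
  then have "stair s (i - 1) j \<le> (\<bar>dev s (i, j)\<bar> + s)\<^sup>2"
    using s by (intro stair_le) (auto simp: abs_if)
  moreover from this s have "s * stair s (i - 1) j \<le> s * (\<bar>dev s (i, j)\<bar> + s)\<^sup>2"
    by (intro mult_left_mono) auto
  moreover have "(\<bar>dev s (i, j)\<bar> + s)\<^sup>2 \<le> c" "s * (\<bar>dev s (i, j)\<bar> + s)\<^sup>2 \<le> c"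
    using assms s by (auto intro!: cost_bounds[of "dev s (i, j)"])
  moreover have "0 \<le> c" using s by (simp add: c_def)
  ultimately show "- (if snd l then c else 0) \<le> edge_weight (stair s) q l"
    "- (if snd l then c else 0) \<le> s * edge_weight (stair s) q l"
    using stair_nonneg[of s i j] s by (cases x; simp)+
qed

text \<open>A positive horizontal letter lowers the deviation by \<open>s\<close> and pays for it
  with its weight; an inverse vertical letter lowers it by one and is charged \<open>c\<close>. The
  other two letters raise it, so the potential does not fall.\<close>

lemma weight_lower_above:
  assumes "\<bar>dev s q\<bar> \<le> M"
  shows "cubic s (dev s q) - cubic s (dev s (q + letter_ab l)) - (if snd l then c else 0)
    \<le> s * edge_weight (stair s) q l"
proof -
  obtain x e i j where [simp]: "l = (x, e)" "q = (i, j)" by force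
  define t where "t = dev s (i, j)"
  show ?thesis
  proof (cases "x = X \<and> \<not> e")
    case True
    have dev: "dev s (i + 1, j) = dev s (i, j) - s" by (simp add: dev_def algebra_simps)
    have "cubic s t - cubic s (t - s) \<le> s * (max 0 (t - (s + 1)/2))\<^sup>2"
      using cubic_diff[of s s "t - s"] s by simp
    also have "(max 0 (t - (s + 1)/2))\<^sup>2 \<le> (max 0 (\<bar>t - s/2\<bar> - 1/2))\<^sup>2"
      using abs_ge_self[of "t - s/2"] by (intro power_mono max.mono) (simp_all add: add_divide_distrib)
    also have "\<dots> \<le> stair s i j" unfolding t_def by (rule stair_ge)
    finally show ?thesis
      using True s dev by (simp add: t_def mult_left_mono)
  next
    case False
    show ?thesis
    proof (cases "x = Y \<and> e")
      case True
      have dev: "dev s (i, j - 1) = dev s (i, j) - 1" by (simp add: dev_def)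
      have "cubic s t - cubic s (t - 1) \<le> (max 0 (t - (s + 1)/2))\<^sup>2"
        using cubic_diff[of 1 s "t - 1"] by simp
      also have "\<dots> \<le> c" using assms s by (intro cost_bounds[of t]) (auto simp: t_def add_divide_distrib)
      finally show ?thesis using True dev by (simp add: t_def)
    next
      case False
      with \<open>\<not> (x = X \<and> \<not> e)\<close> have "dev s (letter_ab l) \<ge> 0" using s by (cases x) (auto simp: dev_def)
      then have "cubic s t \<le> cubic s (dev s (q + letter_ab l))"
        by (intro cubic_mono) (simp add: dev_add t_def)
      with weight_lower(2)[OF assms, of l] show ?thesis by (simp add: t_def)
    qed
  qed
qed

text \<open>The mirror image for deviations below the line, where moving away from the line is what
  costs.\<close>

lemma weight_lower_below:
  assumes "\<bar>dev s q\<bar> \<le> M"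
  shows "- cubic s (- dev s q) - - cubic s (- dev s (q + letter_ab l)) - (if snd l then c else 0)
    \<le> s * edge_weight (stair s) q l"
proof -
  obtain x e i j where [simp]: "l = (x, e)" "q = (i, j)" by force
  define t where "t = dev s (i, j)"
  show ?thesis
  proof (cases "x = X \<and> \<not> e")
    case True
    have dev: "dev s (i + 1, j) = dev s (i, j) - s" by (simp add: dev_def algebra_simps)
    have "cubic s (- t + s) - cubic s (- t) \<le> s * (max 0 (- t + s - (s + 1)/2))\<^sup>2"
      using cubic_diff[of s s "- t"] s by simp
    \<comment> \<open>\<open>- t + s - (s + 1)/2\<close> is \<open>- (t - s/2) - 1/2\<close>: the
      shift in \<open>cubic\<close> serves both sides of the line.\<close>
    also have "(max 0 (- t + s - (s + 1)/2))\<^sup>2 \<le> (max 0 (\<bar>t - s/2\<bar> - 1/2))\<^sup>2"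
      using abs_ge_minus_self[of "t - s/2"] by (intro power_mono max.mono) (simp_all add: add_divide_distrib)
    also have "\<dots> \<le> stair s i j" unfolding t_def by (rule stair_ge)
    finally show ?thesis
      using True s dev by (simp add: t_def mult_left_mono)
  next
    case False
    show ?thesis
    proof (cases "x = Y \<and> e")
      case True
      have dev: "dev s (i, j - 1) = dev s (i, j) - 1" by (simp add: dev_def)
      have "cubic s (- t + 1) - cubic s (- t) \<le> (max 0 (- t + 1 - (s + 1)/2))\<^sup>2"
        using cubic_diff[of 1 s "- t"] by simp
      also have "\<dots> \<le> c" using assms s by (intro cost_bounds[of t]) (auto simp: t_def add_divide_distrib)
      finally show ?thesis using True dev by (simp add: t_def)
    next
      case False
      with \<open>\<not> (x = X \<and> \<not> e)\<close> have "dev s (letter_ab l) \<ge> 0" using s by (cases x) (auto simp: dev_def)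
      then have "cubic s (- dev s (q + letter_ab l)) \<le> cubic s (- t)"
        by (intro cubic_mono) (simp add: dev_add t_def)
      with weight_lower(2)[OF assms, of l] show ?thesis by (simp add: t_def)
    qed
  qed
qed

end

text \<open>If the deviation ever reaches a large \<open>M\<close>, then the positive letters leading there or back cost
  about \<open>M\<^sup>3\<close>, while the boundedly many inverse letters gain at most a multiple of \<open>M\<^sup>2\<close>.\<close>

lemma edge_sum_stair_bounded_below:
  fixes s R :: real and m :: nat
  assumes s: "s \<ge> 0"
  shows "\<exists>K. \<forall>p v. inv_count v \<le> m \<and> \<bar>dev s p\<bar> \<le> R \<and> \<bar>dev s (p + word_ab v)\<bar> \<le> R
    \<longrightarrow> K \<le> edge_sum (stair s) p v"
proof -
  define c where "c M = (1 + s) * (M + s + 1)\<^sup>2" for M :: real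
  have "\<forall>\<^sub>F M in at_top. cubic s M - cubic s R - (1 + s) * (c M * m) > 0"
  proof -
    have "\<forall>\<^sub>F M in at_top. (M - (s + 1)/2) ^ 3 / 3 - cubic s R - (1 + s) * (((1 + s) * (M + s + 1)\<^sup>2) * real m) > 0"
      by real_asymp
    moreover have "\<forall>\<^sub>F M in at_top. M \<ge> (s + 1)/2" by (rule eventually_ge_at_top)
    ultimately show ?thesis by eventually_elim (simp add: cubic_def[of s "_::real"] c_def max_def)
  qed
  then obtain M0 where M0: "\<And>M. M \<ge> M0 \<Longrightarrow> cubic s M - cubic s R - (1 + s) * (c M * m) > 0"
    unfolding eventually_at_top_linorder by blast
  have "- (c \<bar>M0\<bar> * m) \<le> edge_sum (stair s) p v"
    if v: "inv_count v \<le> m" "\<bar>dev s p\<bar> \<le> R" "\<bar>dev s (p + word_ab v)\<bar> \<le> R" for p v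
  proof -
    let ?d = "\<lambda>n. \<bar>dev s (p + word_ab (take n v))\<bar>"
    define M where "M = Max (?d ` {..length v})"
    have "M \<in> ?d ` {..length v}" unfolding M_def by (intro Max_in) auto
    then obtain n where n: "M = ?d n" by blast
    have bound: "?d k \<le> M" for k
    proof -
      have "?d k = ?d (min k (length v))" by (simp add: min_def)
      also have "\<dots> \<le> M" unfolding M_def by (intro Max_ge) auto
      finally show ?thesis .
    qed
    define v1 v2 where "v1 = take n v" and "v2 = drop n v"
    have v12: "v = v1 @ v2" by (simp add: v1_def v2_def)
    have b1: "\<bar>dev s (p + word_ab (take k v1))\<bar> \<le> M" for k
      using bound[of "min k n"] by (simp add: v1_def min_def)
    have b2: "\<bar>dev s (p + word_ab v1 + word_ab (take k v2))\<bar> \<le> M" for k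
      using bound[of "n + k"] by (simp add: v1_def v2_def take_add add.assoc)
    have "M \<ge> 0" by (simp add: n)
    have c0: "0 \<le> c M" using s by (simp add: c_def)
    have count: "c M * inv_count v \<le> c M * m" "c M * inv_count v1 \<le> c M * m" "c M * inv_count v2 \<le> c M * m"
      using v(1) c0 by (auto simp: v12 intro!: mult_left_mono)
    note P = edge_sum_potential[where P = "\<lambda>q. \<bar>dev s q\<bar> \<le> M" and g = "stair s" and c = "c M"]
    have low: "- (c M * inv_count v') \<le> edge_sum (stair s) q v'"
      if "\<And>k. \<bar>dev s (q + word_ab (take k v'))\<bar> \<le> M" for q v'
    proof -
      have "0 - 0 - (if snd l then c M else 0) \<le> 1 * edge_weight (stair s) q l"
        if "\<bar>dev s q\<bar> \<le> M" for q l
        unfolding c_def using weight_lower(1)[OF s that, of l] by simp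
      from P[OF this that] show ?thesis by simp
    qed
    have low': "- (s * (c M * m)) \<le> s * edge_sum (stair s) q v'"
      if "\<And>k. \<bar>dev s (q + word_ab (take k v'))\<bar> \<le> M" "c M * inv_count v' \<le> c M * m" for q v'
      using mult_left_mono[OF order_trans[OF _ low[OF that(1)]] s, of "- (c M * m)"] that(2) by simp
    \<comment> \<open>Above the line the way back \<open>v2\<close> from the extreme point is
      charged, below it the way out \<open>v1\<close>; the other part is bounded below through its
      inverse letters.\<close>
    have large: "cubic s M - cubic s R - (1 + s) * (c M * m) \<le> s * edge_sum (stair s) p v"
    proof (cases "dev s (p + word_ab v1) \<ge> 0")
      case True
      then have "dev s (p + word_ab v1) = M" using n by (simp add: v1_def)
      moreover have "cubic s (dev s (p + word_ab v)) \<le> cubic s R"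
        using v(3) by (intro cubic_mono) simp
      moreover have "cubic s (dev s (p + word_ab v1)) - cubic s (dev s (p + word_ab v1 + word_ab v2))
          - c M * inv_count v2 \<le> s * edge_sum (stair s) (p + word_ab v1) v2"
        unfolding c_def by (rule P[where H = "\<lambda>q. cubic s (dev s q)", unfolded c_def])
          (rule weight_lower_above[OF s] b2; assumption?)+
      ultimately show ?thesis
        using low'[OF b1 count(2)] count(3) by (simp add: v12 edge_sum_append algebra_simps)
    next
      case False
      then have "- dev s (p + word_ab v1) = M" using n by (simp add: v1_def)
      moreover have "cubic s (- dev s p) \<le> cubic s R"
        using v(2) by (intro cubic_mono) simp
      moreover have "- cubic s (- dev s p) - - cubic s (- dev s (p + word_ab v1))
          - c M * inv_count v1 \<le> s * edge_sum (stair s) p v1"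
        unfolding c_def by (rule P[where H = "\<lambda>q. - cubic s (- dev s q)", unfolded c_def])
          (rule weight_lower_below[OF s] b1; assumption?)+
      ultimately show ?thesis
        using low'[OF b2 count(3)] count(2) by (simp add: v12 edge_sum_append algebra_simps)
    qed
    show ?thesis
    proof (cases "M \<ge> M0")
      case True
      \<comment> \<open>For \<open>s = 0\<close> the left side vanishes and the case is
        contradictory: descending by a large amount then takes too many inverse letters.\<close>
      then have "s * edge_sum (stair s) p v > 0" using M0[of M] large by linarith
      then have "edge_sum (stair s) p v > 0" using s by (simp add: zero_less_mult_iff)
      moreover have "0 \<le> c \<bar>M0\<bar> * m" using s by (simp add: c_def)
      ultimately show ?thesis by linarith
    next
      case False
      then have "c M \<le> c \<bar>M0\<bar>"
        unfolding c_def using s \<open>M \<ge> 0\<close> by (intro mult_left_mono power_mono) auto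
      then have "c M * m \<le> c \<bar>M0\<bar> * m" by (intro mult_right_mono) auto
      with low[OF bound] count(1) show ?thesis by linarith
    qed
  qed
  then show ?thesis by blast
qed

section \<open>Staircase rays\<close>

definition letter_aut :: "(gen \<times> bool \<Rightarrow> gen \<times> bool) \<Rightarrow> bool" where
  "letter_aut \<phi> \<longleftrightarrow> bij \<phi> \<and> (\<forall>x e. \<phi> (x, \<not> e) = (fst (\<phi> (x, e)), \<not> snd (\<phi> (x, e))))"

lemma letter_aut_inv:
  assumes "letter_aut \<phi>"
  shows "letter_aut (inv_into UNIV \<phi>)"
proof -
  have b: "bij \<phi>" using assms by (simp add: letter_aut_def)
  have "inv_into UNIV \<phi> (x, \<not> e) = (fst (inv_into UNIV \<phi> (x, e)), \<not> snd (inv_into UNIV \<phi> (x, e)))" for x e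
  proof -
    obtain y f where y: "inv_into UNIV \<phi> (x, e) = (y, f)" by force
    then have "\<phi> (y, f) = (x, e)" by (metis b bij_inv_eq_iff)
    then have "\<phi> (y, \<not> f) = (x, \<not> e)" using assms by (simp add: letter_aut_def)
    then have "inv_into UNIV \<phi> (x, \<not> e) = (y, \<not> f)" by (metis b bij_inv_eq_iff)
    with y show ?thesis by simp
  qed
  with b show ?thesis by (simp add: letter_aut_def bij_imp_bij_inv)
qed

lemma map_word_inv: "letter_aut \<phi> \<Longrightarrow> map \<phi> (word_inv w) = word_inv (map \<phi> w)"
  by (auto simp: letter_aut_def word_inv_def rev_map case_prod_beta)

text \<open>The relations are schemes in arbitrary words, so a letterwise substitution compatible
  with inversion preserves them.\<close>

lemma cartan_eq_map:
  assumes "letter_aut \<phi>" "cartan_eq v w"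
  shows "cartan_eq (map \<phi> v) (map \<phi> w)"
proof -
  have comm: "map \<phi> (word_comm a b) = word_comm (map \<phi> a) (map \<phi> b)" for a b
    using assms(1) by (simp add: word_comm_def map_word_inv)
  show ?thesis
    using assms(2)
    by induction (use assms(1) in \<open>auto simp: map_word_inv comm intro: cartan_eq.intros\<close>)
qed

lemma word_ab_map:
  assumes "letter_aut \<phi>"
  shows "word_ab (map \<phi> w) =
    (fst (word_ab w) * fst (letter_ab (\<phi> (X, False))) + snd (word_ab w) * fst (letter_ab (\<phi> (Y, False))),
     fst (word_ab w) * snd (letter_ab (\<phi> (X, False))) + snd (word_ab w) * snd (letter_ab (\<phi> (Y, False))))"
proof (induction w)
  case (Cons l w)
  obtain x e where l: "l = (x, e)" by force
  have neg: "letter_ab (y, \<not> f) = - letter_ab (y, f)" for y f by (cases y) auto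
  have "\<phi> (x, True) = (fst (\<phi> (x, False)), \<not> snd (\<phi> (x, False)))"
    using assms unfolding letter_aut_def by (metis (full_types))
  then have "letter_ab (\<phi> (x, True)) = - letter_ab (\<phi> (x, False))" by (simp add: neg)
  then show ?case
    using Cons by (cases x; cases e) (simp_all add: l prod_eq_iff algebra_simps)
qed (simp add: zero_prod_def)

text \<open>The images of the two generators lie on different axes, since injectivity keeps the
  image of \<open>Y\<close> apart from those of \<open>X\<close> and its inverse. The first claim
  says that the direction \<open>(1, s)\<close> keeps its l1-norm.\<close>

lemma letter_aut_axes:
  fixes s :: real
  assumes "letter_aut \<phi>" "s \<ge> 0"
  shows "\<bar>real_of_int (fst (letter_ab (\<phi> (X, False)))) + s * fst (letter_ab (\<phi> (Y, False)))\<bar>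
      + \<bar>real_of_int (snd (letter_ab (\<phi> (X, False)))) + s * snd (letter_ab (\<phi> (Y, False)))\<bar> = 1 + s"
    and "\<bar>fst (letter_ab (\<phi> (X, False)))\<bar> + \<bar>fst (letter_ab (\<phi> (Y, False)))\<bar> = 1"
    and "\<bar>snd (letter_ab (\<phi> (X, False)))\<bar> + \<bar>snd (letter_ab (\<phi> (Y, False)))\<bar> = 1"
proof -
  obtain x e y f where xy: "\<phi> (X, False) = (x, e)" "\<phi> (Y, False) = (y, f)" by force
  have "x \<noteq> y"
  proof
    assume "x = y"
    with xy assms have "\<phi> (Y, False) = \<phi> (X, False) \<or> \<phi> (Y, False) = \<phi> (X, True)"
      unfolding letter_aut_def by (metis (full_types) fst_conv snd_conv)
    moreover have "inj \<phi>" using assms by (simp add: letter_aut_def bij_is_inj)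
    ultimately show False by (auto dest: injD)
  qed
  then show "\<bar>real_of_int (fst (letter_ab (\<phi> (X, False)))) + s * fst (letter_ab (\<phi> (Y, False)))\<bar>
      + \<bar>real_of_int (snd (letter_ab (\<phi> (X, False)))) + s * snd (letter_ab (\<phi> (Y, False)))\<bar> = 1 + s"
    "\<bar>fst (letter_ab (\<phi> (X, False)))\<bar> + \<bar>fst (letter_ab (\<phi> (Y, False)))\<bar> = 1"
    "\<bar>snd (letter_ab (\<phi> (X, False)))\<bar> + \<bar>snd (letter_ab (\<phi> (Y, False)))\<bar> = 1"
    using assms(2) unfolding xy by (cases x; cases y; auto)+
qed

section \<open>Positive words of weight zero\<close>

lemma edge_sum_stair_nonneg:
  assumes "inv_count w = 0"
  shows "0 \<le> edge_sum (stair s) p w"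
  using assms
proof (induction w arbitrary: p)
  case (Cons l w)
  obtain x e i j where "l = (x, e)" "p = (i, j)" by force
  with Cons show ?case by (cases x) (auto simp: stair_nonneg split: if_splits)
qed simp

lemma stair_eq_0D:
  assumes "stair s i j = 0"
  shows "- (1/2) \<le> real_of_int j - s * (real_of_int i + 1/2)"
    "real_of_int j - s * (real_of_int i + 1/2) \<le> 1/2"
  using assms unfolding stair_eq_0_iff by linarith+

text \<open>The first horizontal letter runs along a nearest edge, so the deviation there is at most
  \<open>(s + 1)/2\<close>; vertical letters before it only raise the deviation.\<close>

lemma dev_upper:
  assumes "s \<ge> 0" "inv_count w = 0" "edge_sum (stair s) p w = 0" "X \<in> fst ` set w"
  shows "dev s p \<le> (s + 1)/2"
  using assms(2-)
proof (induction w arbitrary: p)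
  case (Cons l w)
  obtain x e i j where l: "l = (x, e)" and p: "p = (i, j)" by force
  have e: "\<not> e" "inv_count w = 0" using Cons.prems(1) by (auto simp: l split: if_splits)
  show ?case
  proof (cases x)
    case X
    have "stair s i j = 0"
      using Cons.prems(2) X e edge_sum_stair_nonneg[OF e(2), of s] stair_nonneg[of s i j]
      by (simp add: l p) (smt (verit))
    from stair_eq_0D(2)[OF this] show ?thesis
      by (simp add: p dev_def add_divide_distrib algebra_simps)
  next
    case Y
    have "dev s (i, j + 1) \<le> (s + 1)/2"
      using Cons.prems e Y by (intro Cons.IH) (auto simp: l p)
    then show ?thesis by (simp add: p dev_def)
  qed
qed simp

text \<open>After the last horizontal letter the deviation is at least \<open>- ((s + 1)/2)\<close>,
  and vertical letters only raise it; hence the induction from the end.\<close>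

lemma dev_lower:
  assumes "s \<ge> 0" "inv_count w = 0" "edge_sum (stair s) (0, 0) w = 0"
  shows "- ((s + 1)/2) \<le> dev s (word_ab w)"
  using assms(2-)
proof (induction w rule: rev_induct)
  case Nil
  then show ?case using assms(1) by (simp add: dev_def)
next
  case (snoc l w)
  obtain x e i j where l: "l = (x, e)" and p: "word_ab w = (i, j)" by force
  have e: "\<not> e" "inv_count w = 0" using snoc.prems(1) by (auto simp: l split: if_splits)
  have sum: "edge_sum (stair s) (0, 0) w + edge_weight (stair s) (i, j) l = 0"
    using snoc.prems(2) by (simp add: edge_sum_append p)
  show ?case
  proof (cases x)
    case X
    have "stair s i j = 0"
      using sum X e edge_sum_stair_nonneg[OF e(2), of s] stair_nonneg[of s i j]
      by (simp add: l) (smt (verit))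
    from stair_eq_0D(1)[OF this] show ?thesis
      using X e(1) by (simp add: l p dev_def add_divide_distrib algebra_simps)
  next
    case Y
    then have "- ((s + 1)/2) \<le> dev s (i, j)" using sum snoc.IH e by (simp add: l p)
    then show ?thesis using Y e(1) by (simp add: l p dev_def)
  qed
qed

text \<open>With \<open>?x\<close> the height of the line, raising by \<open>d\<close> adds
  \<open>2 * d * (j - ?x) + d\<^sup>2\<close>, which is at least \<open>d\<^sup>2 - d\<close>. For
  \<open>d = 1\<close> this can vanish at a tie, hence shifts by at least two.\<close>

lemma stair_shift:
  assumes "stair s i j = 0" "d \<ge> 2"
  shows "2 \<le> stair s i (j + d)"
proof -
  let ?x = "s * (real_of_int i + 1/2)"
  have "- 1/2 \<le> real_of_int j - ?x" using stair_eq_0D(1)[OF assms(1)] by simp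
  then have "2 * real_of_int d * (- 1/2) \<le> 2 * real_of_int d * (real_of_int j - ?x)"
    using assms(2) by (intro mult_left_mono) auto
  moreover have "stair s i (j + d) = stair s i j + 2 * real_of_int d * (real_of_int j - ?x) + (real_of_int d)\<^sup>2"
    by (simp add: stair_def power2_eq_square algebra_simps)
  moreover have "2 * real_of_int d \<le> (real_of_int d)\<^sup>2"
    using assms(2) by (simp add: power2_eq_square)
  moreover have "2 \<le> real_of_int d" using assms(2) by simp
  ultimately show ?thesis using assms(1) by linarith
qed

text \<open>Normal form of the rays: \<open>\<phi>\<close> carries a path in the closed positive
  quadrant to the ray. A vertical ray is obtained by exchanging the generators, so that the slope
  \<open>s\<close> stays finite.\<close>

locale staircase_ray =
  fixes \<phi> :: "gen \<times> bool \<Rightarrow> gen \<times> bool" and s :: real and l :: "nat \<Rightarrow> gen \<times> bool"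
  assumes aut: "letter_aut \<phi>" and s: "s \<ge> 0"
    and positive: "\<not> snd (l n)"
    and on_stair: "fst (l n) = X \<Longrightarrow>
      stair s (fst (word_ab (map l [0..<n]))) (snd (word_ab (map l [0..<n]))) = 0"
    and infinitely_horizontal: "\<exists>n\<ge>N. fst (l n) = X"
begin

abbreviation W :: "nat \<Rightarrow> word" where "W n \<equiv> map l [0..<n]"
abbreviation pos :: "nat \<Rightarrow> int \<times> int" where "pos n \<equiv> word_ab (W n)"

lemma map_inv: "map (inv_into UNIV \<phi>) (map \<phi> w) = w" "map \<phi> (map (inv_into UNIV \<phi>) w) = w"
proof -
  have "bij \<phi>" using aut by (simp add: letter_aut_def)
  then show "map (inv_into UNIV \<phi>) (map \<phi> w) = w" "map \<phi> (map (inv_into UNIV \<phi>) w) = w"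
    by (simp_all add: bij_is_inj surj_iff[THEN iffD1, OF bij_is_surj])
qed

lemma cartan_eq_unmap: "elt v = elt (map \<phi> w) \<Longrightarrow> cartan_eq (map (inv_into UNIV \<phi>) v) w"
  using cartan_eq_map[OF letter_aut_inv[OF aut], of v "map \<phi> w"] by (simp only: elt_eq_iff map_inv)

lemma word_ab_unmap: "elt v = elt (map \<phi> w) \<Longrightarrow> word_ab (map (inv_into UNIV \<phi>) v) = word_ab w"
  using arg_cong[OF elt_eq_iff[THEN iffD2, OF cartan_eq_unmap], of v w cartan_ab]
  by (simp only: cartan_ab.abs_eq)

lemma inv_count_W [simp]: "inv_count (W n) = 0"
  using positive by (induction n) auto

lemma pos_sum: "fst (pos n) + snd (pos n) = int n"
  using word_ab_sum[of "W n"] by simp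

lemma edge_sum_W [simp]: "edge_sum (stair s) (0, 0) (W n) = 0"
proof (induction n)
  case (Suc n)
  obtain x e i j where *: "l n = (x, e)" "pos n = (i, j)" by force
  then have "\<not> e" using positive[of n] by simp
  with Suc * on_stair[of n] show ?case by (cases x) (simp_all add: edge_sum_append)
qed simp

lemma fst_pos_Suc: "fst (pos (Suc n)) = fst (pos n) + (if fst (l n) = X then 1 else 0)"
proof -
  obtain x e where *: "l n = (x, e)" by force
  then show ?thesis using positive[of n] by (cases x) simp_all
qed

lemma fst_pos_mono: "m \<le> n \<Longrightarrow> fst (pos m) \<le> fst (pos n)"
  by (rule lift_Suc_mono_le[of "\<lambda>n. fst (pos n)"]) (subst fst_pos_Suc, simp)

lemma fst_pos_unbounded: "\<exists>N. \<forall>n\<ge>N. int k \<le> fst (pos n)"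
proof (induction k)
  case 0
  show ?case using fst_pos_mono[of 0] by (auto intro!: exI[of _ 0])
next
  case (Suc k)
  then obtain N where N: "\<And>n. n \<ge> N \<Longrightarrow> int k \<le> fst (pos n)" by blast
  obtain m where m: "m \<ge> N" "fst (l m) = X" using infinitely_horizontal by blast
  then have "int (Suc k) \<le> fst (pos (Suc m))" using N[of m] by (simp only: fst_pos_Suc) simp
  then show ?case using fst_pos_mono[of "Suc m"] by (intro exI[of _ "Suc m"]) (meson order_trans)
qed

lemma clen_ray: "clen (map \<phi> (W n)) = n"
proof (rule antisym)
  show "clen (map \<phi> (W n)) \<le> n" using clen_le[of "map \<phi> (W n)"] by simp
  obtain v where v: "length v = clen (map \<phi> (W n))" "elt v = elt (map \<phi> (W n))"
    by (rule clen_attained)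
  \<comment> \<open>The coordinate sum of a word is at most its length, and for \<open>W n\<close>
    it equals \<open>n\<close>.\<close>
  then show "n \<le> clen (map \<phi> (W n))"
    using word_ab_sum[of "map (inv_into UNIV \<phi>) v"] word_ab_unmap[OF v(2)] pos_sum[of n] by simp
qed

sublocale geodesic_word_ray "\<phi> \<circ> l"
  by unfold_locales (use clen_ray in \<open>simp add: comp_def\<close>)

lemma ray_eq: "ray n = elt (map \<phi> (W n))"
  by (simp add: comp_def)

text \<open>A path in the equality case of the triangle inequality for the Busemann function is made of positive letters
  of total weight zero, hence follows the line of slope \<open>s\<close> as well.\<close>

lemma dev_of_bus_eq:
  assumes "length w = m" "bus (elt w) = - real m"
  defines "w' \<equiv> map (inv_into UNIV \<phi>) w"
  shows "fst (word_ab w') + snd (word_ab w') = int m" "\<bar>dev s (word_ab w')\<bar> \<le> (s + 1)/2"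
proof -
  \<comment> \<open>Beyond \<open>N\<close> the first coordinate of the ray exceeds
    \<open>m\<close>, the length of \<open>w\<close>, so the continuation \<open>v\<close> must
    contain a horizontal letter.\<close>
  obtain N where N: "\<And>n. n \<ge> N \<Longrightarrow> int (Suc m) \<le> fst (pos n)" using fst_pos_unbounded by blast
  obtain n v where n: "n \<ge> N" and len: "real (length v) = real n + bus (elt w)"
    and v: "elt w \<otimes>\<^bsub>cartan_group\<^esub> elt v = ray n" by (rule bus_path)
  from len assms(2) have len: "length w + length v = n" using assms(1) by linarith
  let ?w = "map (inv_into UNIV \<phi>) w" and ?v = "map (inv_into UNIV \<phi>) v"
  from v have eq: "elt (w @ v) = elt (map \<phi> (W n))" by (simp add: comp_def)
  have ab: "word_ab (?w @ ?v) = pos n" using word_ab_unmap[OF eq] by simp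
  have "length (?w @ ?v) = n" using len by simp
  then have "inv_count (?w @ ?v) = 0"
    using word_ab_sum[of "?w @ ?v"] unfolding ab pos_sum by simp
  then have cnt: "inv_count ?w = 0" "inv_count ?v = 0" by auto
  \<comment> \<open>The weight depends only on the group element, so the total is that of the ray,
    zero; both parts are nonnegative.\<close>
  have "edge_sum (stair s) (0, 0) (?w @ ?v) = edge_sum (stair s) (0, 0) (W n)"
    using cartan_eq_unmap[OF eq] by (intro edge_sum_cartan_eq invariant_weight_stair) simp
  then have "edge_sum (stair s) (0, 0) ?w + edge_sum (stair s) (word_ab ?w) ?v = 0"
    by (simp only: edge_sum_W edge_sum_append) (simp flip: zero_prod_def)
  with edge_sum_stair_nonneg[OF cnt(1)] edge_sum_stair_nonneg[OF cnt(2)]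
  have sums: "edge_sum (stair s) (0, 0) ?w = 0" "edge_sum (stair s) (word_ab ?w) ?v = 0"
    by (smt (verit))+
  have fst_le: "fst (word_ab v) \<le> length v" for v
  proof (induction v)
    case (Cons l w)
    obtain x e where "l = (x, e)" by force
    with Cons show ?case by (cases x) auto
  qed simp
  have "X \<in> fst ` set ?v"
  proof (rule ccontr)
    assume noX: "X \<notin> fst ` set ?v"
    have "fst (word_ab v) = 0" if "X \<notin> fst ` set v" for v
      using that
    proof (induction v)
      case (Cons l w)
      obtain x e where "l = (x, e)" by force
      with Cons show ?case by (cases x) auto
    qed simp
    with noX have "fst (word_ab ?w) = fst (pos n)" using ab[symmetric] by simp
    with N[OF n] fst_le[of ?w] assms(1) show False by simp
  qed
  then have "dev s (word_ab ?w) \<le> (s + 1)/2" using dev_upper[OF s cnt(2) sums(2)] by blast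
  moreover have "- ((s + 1)/2) \<le> dev s (word_ab ?w)" by (rule dev_lower[OF s cnt(1) sums(1)])
  ultimately show "\<bar>dev s (word_ab w')\<bar> \<le> (s + 1)/2"
    unfolding w'_def by linarith
  show "fst (word_ab w') + snd (word_ab w') = int m"
    using word_ab_sum[of ?w] cnt assms(1) by (simp add: w'_def)
qed

lemma dev_pos: "\<bar>dev s (pos n)\<bar> \<le> (s + 1)/2"
proof -
  have "bus (elt (map \<phi> (W n))) = - real n" using bus_ray[of n] by (simp only: ray_eq)
  from dev_of_bus_eq(2)[OF _ this] show ?thesis by (simp only: map_inv length_map length_upt diff_zero)
qed

text \<open>Coordinate sum \<open>m\<close> and bounded deviation put the end point near
  \<open>m / (1 + s)\<close> times \<open>(1, s)\<close>. \<open>\<phi>\<close> carries this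
  direction to that of \<open>(u1, u2)\<close>, whose l1-norm is \<open>r * (1 + s)\<close>.\<close>

lemma direction:
  assumes "length w = m" "bus (elt w) = - real m"
    and r: "r > 0"
    and u: "u1 = r * (fst (letter_ab (\<phi> (X, False))) + s * fst (letter_ab (\<phi> (Y, False))))"
      "u2 = r * (snd (letter_ab (\<phi> (X, False))) + s * snd (letter_ab (\<phi> (Y, False))))"
  shows "\<bar>fst (word_ab w) - real m * (u1 / (\<bar>u1\<bar> + \<bar>u2\<bar>))\<bar> \<le> 1"
    "\<bar>snd (word_ab w) - real m * (u2 / (\<bar>u1\<bar> + \<bar>u2\<bar>))\<bar> \<le> 1"
proof -
  obtain a b where ab: "word_ab (map (inv_into UNIV \<phi>) w) = (a, b)" by force
  have sum: "a + b = int m" and dev: "\<bar>dev s (a, b)\<bar> \<le> (s + 1)/2"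
    using dev_of_bus_eq[OF assms(1,2)] by (simp_all add: ab)
  have w: "word_ab w = word_ab (map \<phi> (map (inv_into UNIV \<phi>) w))" by (simp only: map_inv)
  let ?c = "letter_ab (\<phi> (X, False))" and ?d = "letter_ab (\<phi> (Y, False))"
  have "\<bar>u1\<bar> + \<bar>u2\<bar> = r * (\<bar>real_of_int (fst ?c) + s * fst ?d\<bar> + \<bar>real_of_int (snd ?c) + s * snd ?d\<bar>)"
  proof -
    have "\<bar>r * x\<bar> = r * \<bar>x\<bar>" for x using r by (simp add: abs_mult)
    then show ?thesis unfolding u by (simp only: distrib_left[of r "\<bar>_\<bar>"])
  qed
  then have norm: "\<bar>u1\<bar> + \<bar>u2\<bar> = r * (1 + s)" by (simp only: letter_aut_axes(1)[OF aut s])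
  \<comment> \<open>The errors before \<open>\<phi>\<close> is applied. Both have absolute value
    \<open>\<bar>dev s (a, b)\<bar> / (1 + s)\<close>, and each coordinate of the image contains
    just one of them, up to sign.\<close>
  define \<alpha> \<beta> where "\<alpha> = real_of_int a - real m / (1 + s)" and "\<beta> = real_of_int b - real m * s / (1 + s)"
  have m: "real m = real_of_int a + real_of_int b" using sum by (metis of_int_add of_int_of_nat_eq)
  have "\<alpha> * (1 + s) = - dev s (a, b)" "\<beta> * (1 + s) = dev s (a, b)"
    using s by (simp_all add: \<alpha>_def \<beta>_def dev_def m field_simps)
  then have "\<bar>\<alpha>\<bar> * (1 + s) = \<bar>dev s (a, b)\<bar>" "\<bar>\<beta>\<bar> * (1 + s) = \<bar>dev s (a, b)\<bar>"
    using s abs_mult[of \<alpha> "1 + s"] abs_mult[of \<beta> "1 + s"] by simp_all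
  moreover have "\<bar>x\<bar> \<le> 1/2" if "\<bar>x\<bar> * (1 + s) = \<bar>dev s (a, b)\<bar>" for x
    by (rule mult_right_le_imp_le[of _ "1 + s"]) (use that dev s in \<open>simp_all add: add.commute\<close>)
  ultimately have small: "\<bar>\<alpha>\<bar> \<le> 1/2" "\<bar>\<beta>\<bar> \<le> 1/2" by blast+
  have scale: "real m * (r * x / (r * (1 + s))) = real m * x / (1 + s)" for x
    using r by simp
  have combine: "\<bar>\<alpha> * real_of_int c + \<beta> * real_of_int d\<bar> \<le> 1" if "\<bar>c\<bar> + \<bar>d\<bar> = 1" for c d
  proof -
    have "c = 0 \<and> \<bar>d\<bar> = 1 \<or> d = 0 \<and> \<bar>c\<bar> = 1" using that by linarith
    then show ?thesis using small by (auto simp: abs_if split: if_splits)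
  qed
  have "fst (word_ab w) - real m * (u1 / (\<bar>u1\<bar> + \<bar>u2\<bar>)) = \<alpha> * fst ?c + \<beta> * fst ?d"
    unfolding norm unfolding w word_ab_map[OF aut] ab u scale \<alpha>_def \<beta>_def
    by (simp add: add_divide_distrib algebra_simps)
  then show "\<bar>fst (word_ab w) - real m * (u1 / (\<bar>u1\<bar> + \<bar>u2\<bar>))\<bar> \<le> 1"
    using combine[OF letter_aut_axes(2)[OF aut s]] by simp
  have "snd (word_ab w) - real m * (u2 / (\<bar>u1\<bar> + \<bar>u2\<bar>)) = \<alpha> * snd ?c + \<beta> * snd ?d"
    unfolding norm unfolding w word_ab_map[OF aut] ab u scale \<alpha>_def \<beta>_def
    by (simp add: add_divide_distrib algebra_simps)
  then show "\<bar>snd (word_ab w) - real m * (u2 / (\<bar>u1\<bar> + \<bar>u2\<bar>))\<bar> \<le> 1"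
    using combine[OF letter_aut_axes(3)[OF aut s]] by simp
qed

lemma edge_sum_shifted:
  assumes "d \<ge> 2"
  shows "2 * fst (pos n) \<le> edge_sum (stair s) (0, d) (W n)"
proof (induction n)
  case (Suc n)
  obtain x e i j where *: "l n = (x, e)" "pos n = (i, j)" by force
  then have "\<not> e" using positive[of n] by simp
  with Suc * on_stair[of n] stair_shift[OF _ assms, of s i j] show ?case
    by (cases x) (simp_all add: edge_sum_append add.commute)
qed simp

text \<open>The even exponent makes every nonzero shift at least two, as \<open>stair_shift\<close>
  asks.\<close>

definition shift :: "nat \<Rightarrow> word" where "shift d = map \<phi> (replicate (2 * d) (Y, False))"

text \<open>Translating the ray by an even power of the second generator makes each of its horizontal edges cost
  at least two.\<close>

lemma bus_shift_unbounded:
  assumes "d \<ge> 1"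
  shows "\<exists>m. bus (elt (shift d @ map \<phi> (W m))) > B - real m"
proof (rule ccontr)
  assume "\<nexists>m. bus (elt (shift d @ map \<phi> (W m))) > B - real m"
  then have le: "bus (elt (shift d @ map \<phi> (W m))) \<le> B - real m" for m by (auto simp: not_less)
  \<comment> \<open>\<open>k\<close> bounds the inverse letters of the connecting path and
    \<open>R\<close> the deviation of its two ends; neither depends on \<open>m\<close>.\<close>
  define k where "k = nat \<lceil>B\<rceil> + 2 * d"
  define R where "R = (s + 1)/2 + 2 * real d"
  obtain K where K: "\<And>p v. inv_count v \<le> k \<Longrightarrow> \<bar>dev s p\<bar> \<le> R \<Longrightarrow> \<bar>dev s (p + word_ab v)\<bar> \<le> R
      \<Longrightarrow> K \<le> edge_sum (stair s) p v"
    using edge_sum_stair_bounded_below[OF s] by metis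
  have rep: "word_ab (replicate i (Y, False)) = (0, int i)" for i
    by (induction i) (auto simp: zero_prod_def)
  have rep0: "edge_sum (stair s) p (replicate i (Y, False)) = 0" for i p
    by (induction i arbitrary: p) (auto split: prod.splits)
  \<comment> \<open>The shifted ray, continued by \<open>?v\<close>, ends on the ray, so the total
    weight is zero. The shifted ray contributes at least \<open>2 * fst (pos m)\<close>, the
    continuation at least \<open>K\<close>.\<close>
  have bound: "K + 2 * fst (pos m) \<le> 0" for m
  proof -
    obtain n v where n: "n \<ge> m"
      and len: "real (length v) = real n + bus (elt (shift d @ map \<phi> (W m)))"
      and v: "elt (shift d @ map \<phi> (W m)) \<otimes>\<^bsub>cartan_group\<^esub> elt v = ray n" by (rule bus_path)
    let ?v = "map (inv_into UNIV \<phi>) v" and ?r = "replicate (2 * d) (Y, False)"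
    from v have eq: "elt (map \<phi> (?r @ W m) @ v) = elt (map \<phi> (W n))" by (simp add: comp_def shift_def)
    have unmap: "map (inv_into UNIV \<phi>) (map \<phi> (?r @ W m) @ v) = ?r @ W m @ ?v"
      by (simp only: map_append[of "inv_into UNIV \<phi>"] map_inv append_assoc)
    have ab: "(0, int (2 * d)) + pos m + word_ab ?v = pos n"
      using word_ab_unmap[OF eq] unfolding unmap by (simp add: rep add.assoc)
    have "fst (word_ab ?v) + snd (word_ab ?v) + 2 * int d + int m = int n"
      using pos_sum[of m] pos_sum[of n] by (simp flip: ab)
    then have "2 * int (inv_count ?v) = int (length v) + 2 * int d + int m - int n"
      using word_ab_sum[of ?v] by simp
    moreover have "real (length v) \<le> real n + B - real m" using len le[of m] by linarith
    ultimately have cnt: "inv_count ?v \<le> k" unfolding k_def by linarith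
    have sum: "edge_sum (stair s) (0, 0) (?r @ W m @ ?v) = edge_sum (stair s) (0, 0) (W n)"
      using cartan_eq_unmap[OF eq] unfolding unmap
      by (intro edge_sum_cartan_eq invariant_weight_stair)
    then have "edge_sum (stair s) (0, int (2 * d)) (W m)
        + edge_sum (stair s) ((0, int (2 * d)) + pos m) ?v = 0"
      by (simp add: edge_sum_append rep rep0)
    moreover have "dev s ((0, int (2 * d)) + pos m) = dev s (pos m) + 2 * d"
      by (simp add: dev_add) (simp add: dev_def)
    then have "\<bar>dev s ((0, int (2 * d)) + pos m)\<bar> \<le> R" "\<bar>dev s ((0, int (2 * d)) + pos m + word_ab ?v)\<bar> \<le> R"
      using dev_pos[of m] dev_pos[of n] unfolding ab R_def by linarith+
    then have "K \<le> edge_sum (stair s) ((0, int (2 * d)) + pos m) ?v"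
      using cnt by (intro K)
    moreover have "2 * fst (pos m) \<le> edge_sum (stair s) (0, int (2 * d)) (W m)"
      using assms by (intro edge_sum_shifted) simp
    ultimately show ?thesis by linarith
  qed
  obtain m where "int (nat \<lceil>\<bar>K\<bar>\<rceil> + 1) \<le> fst (pos m)" using fst_pos_unbounded by blast
  with bound[of m] show False by linarith
qed

end

section \<open>The rays are staircase rays\<close>

text \<open>\<open>t\<close> exchanges the generators, \<open>ex\<close> and \<open>ey\<close>
  invert the images of \<open>X\<close> and \<open>Y\<close>; \<open>\<noteq>\<close> on the flags
  multiplies signs.\<close>

fun relabel :: "bool \<Rightarrow> bool \<Rightarrow> bool \<Rightarrow> gen \<times> bool \<Rightarrow> gen \<times> bool" where
  "relabel t ex ey (X, e) = (if t then Y else X, e \<noteq> ex)"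
| "relabel t ex ey (Y, e) = (if t then X else Y, e \<noteq> ey)"

lemma letter_aut_relabel: "letter_aut (relabel t ex ey)"
proof -
  have "inj (relabel t ex ey)"
  proof (rule injI)
    fix l m assume "relabel t ex ey l = relabel t ex ey m"
    moreover obtain x e y f where "l = (x, e)" "m = (y, f)" by force
    ultimately show "l = m" by (cases x; cases y) (auto split: if_splits)
  qed
  moreover have "surj (relabel t ex ey)"
  proof (rule surjI)
    fix l
    show "relabel t ex ey (if (fst l = X) = t then (Y, snd l \<noteq> ey) else (X, snd l \<noteq> ex)) = l"
      by (cases l; cases "fst l") auto
  qed
  moreover have "relabel t ex ey (x, \<not> e) =
      (fst (relabel t ex ey (x, e)), \<not> snd (relabel t ex ey (x, e)))" for x e
    by (cases x) auto
  ultimately show ?thesis by (simp add: letter_aut_def bij_def)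
qed

lemma letter_ab_inject: "letter_ab l = letter_ab m \<Longrightarrow> l = m"
proof -
  assume "letter_ab l = letter_ab m"
  moreover obtain x e y f where "l = (x, e)" "m = (y, f)" by force
  ultimately show "l = m" by (cases x; cases y) (auto split: if_splits)
qed

lemma cartan_ray_word:
  assumes "cartan_ray u \<gamma>"
  obtains L where "\<gamma> = (\<lambda>n. elt (map L [0..<n]))"
    "lattice_ray u (\<lambda>n. word_ab (map L [0..<n]))"
proof -
  have "\<forall>n. \<exists>l. \<gamma> (Suc n) = \<gamma> n \<otimes>\<^bsub>cartan_group\<^esub> elt [l]"
    using assms unfolding cartan_ray_def cartan_gens_eq by blast
  from choice[OF this] obtain L where L: "\<And>n. \<gamma> (Suc n) = \<gamma> n \<otimes>\<^bsub>cartan_group\<^esub> elt [L n]" by blast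
  have "\<gamma> n = elt (map L [0..<n])" for n
    using assms by (induction n) (simp_all add: L elt_one cartan_ray_def)
  then have \<gamma>: "\<gamma> = (\<lambda>n. elt (map L [0..<n]))" by blast
  then have "lattice_ray u (\<lambda>n. word_ab (map L [0..<n]))"
    using assms by (simp add: cartan_ray_def cartan_ab.abs_eq)
  with \<gamma> show ?thesis using that by blast
qed

lemma positive_word_ab_mono:
  assumes "\<And>n. \<not> snd (l n)" "m \<le> n"
  shows "fst (word_ab (map l [0..<m])) \<le> fst (word_ab (map l [0..<n]))"
    "snd (word_ab (map l [0..<m])) \<le> snd (word_ab (map l [0..<n]))"
proof -
  have "fst (word_ab (map l [0..<n])) \<le> fst (word_ab (map l [0..<Suc n])) \<and>
      snd (word_ab (map l [0..<n])) \<le> snd (word_ab (map l [0..<Suc n]))" for n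
  proof -
    obtain x e where "l n = (x, e)" by force
    then show ?thesis using assms(1)[of n] by (cases x) auto
  qed
  then show "fst (word_ab (map l [0..<m])) \<le> fst (word_ab (map l [0..<n]))"
    "snd (word_ab (map l [0..<m])) \<le> snd (word_ab (map l [0..<n]))"
    using lift_Suc_mono_le[of "\<lambda>n. fst (word_ab (map l [0..<n]))", OF _ assms(2)]
      lift_Suc_mono_le[of "\<lambda>n. snd (word_ab (map l [0..<n]))", OF _ assms(2)] by blast+
qed

lemma staircase_ray_straight:
  assumes "letter_aut \<phi>"
  shows "staircase_ray \<phi> 0 (\<lambda>_. (X, False))"
proof
  fix n
  have "word_ab (map (\<lambda>_. (X, False)) [0..<n]) = (int n, 0)"
    by (induction n) (simp_all add: zero_prod_def)
  then show "stair 0 (fst (word_ab (map (\<lambda>_. (X, False)) [0..<n])))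
      (snd (word_ab (map (\<lambda>_. (X, False)) [0..<n]))) = 0"
    by (simp add: stair_def)
qed (use assms in auto)

text \<open>A horizontal step in column \<open>i\<close> at height \<open>j\<close> runs between the
  squares \<open>(i, j)\<close> and \<open>(i, j - 1)\<close>, so the line crosses the middle of the
  column at a height between \<open>j - 1/2\<close> and \<open>j + 1/2\<close>. By
  \<open>stair_eq_0_iff\<close> the step has weight zero.\<close>

lemma staircase_ray_of_division:
  fixes u :: "real \<times> real" and l :: "nat \<Rightarrow> gen \<times> bool"
  defines "a \<equiv> \<lambda>n. fst (word_ab (map l [0..<n]))" and "b \<equiv> \<lambda>n. snd (word_ab (map l [0..<n]))"
  assumes u: "fst u \<noteq> 0" "snd u \<noteq> 0" and aut: "letter_aut \<phi>"
    and positive: "\<And>n. \<not> snd (l n)"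
    and p: "\<And>n. \<bar>fst (p n)\<bar> = a n" "\<And>n. \<bar>snd (p n)\<bar> = b n"
    and A: "square_division u A"
    and vert: "\<And>i j. A i j \<Longrightarrow> vertical_side p i j"
    and horiz: "\<And>i j. \<not> A i j \<Longrightarrow> horizontal_side p i j"
  shows "staircase_ray \<phi> (\<bar>snd u\<bar> / \<bar>fst u\<bar>) l"
proof
  show "letter_aut \<phi>" by (rule aut)
  show "0 \<le> \<bar>snd u\<bar> / \<bar>fst u\<bar>" by simp
  show "\<not> snd (l n)" for n by (rule positive)
  have mono: "a m \<le> a n" "b m \<le> b n" if "m \<le> n" for m n
    unfolding a_def b_def using positive_word_ab_mono[of l] positive that by blast+
  have nonneg: "0 \<le> a n" "0 \<le> b n" for n using p[of n] by (metis abs_ge_zero)+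
  have off_A: "0 \<le> ray_offset u i j" if "A i j" for i j
    using A that unfolding square_division_def by (meson not_le)
  have off_nA: "ray_offset u i j \<le> 0" if "\<not> A i j" for i j
    using A that unfolding square_division_def by (meson not_le)
  show "stair (\<bar>snd u\<bar> / \<bar>fst u\<bar>) (fst (word_ab (map l [0..<n]))) (snd (word_ab (map l [0..<n]))) = 0"
    if horizontal: "fst (l n) = X" for n
  proof -
    obtain e where "l n = (X, e)" using horizontal by (cases "l n") auto
    then have step: "a (Suc n) = a n + 1" using positive[of n] by (simp add: a_def)
    obtain i j where ij: "a n = int i" "b n = int j" using nonneg by (metis nonneg_eq_int)
    \<comment> \<open>Otherwise the path visits a vertex above the square in abscissa at most
      \<open>i\<close>. Up to time \<open>n\<close> the path is too low for this, afterwards too far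
      to the right.\<close>
    have "A i j"
    proof (rule ccontr)
      assume "\<not> A i j"
      then obtain k where k: "a k \<le> int i" "b k \<ge> int j + 1"
        using horiz[of i j] p unfolding horizontal_side_def by metis
      show False
      proof (cases "k \<le> n")
        case True
        with mono(2)[OF True] k ij show False by simp
      next
        case False
        with mono(1)[of "Suc n" k] k ij step show False by simp
      qed
    qed
    from off_A[OF this] have "\<bar>snd u\<bar> * (real i + 1/2) \<le> \<bar>fst u\<bar> * (real j + 1/2)"
      by (simp add: ray_offset_def)
    then have lower: "\<bar>snd u\<bar> / \<bar>fst u\<bar> * (real i + 1/2) \<le> real j + 1/2"
      using u by (simp add: field_simps)
    have upper: "real j - 1/2 \<le> \<bar>snd u\<bar> / \<bar>fst u\<bar> * (real i + 1/2)"
    proof (cases j)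
      \<comment> \<open>Here no square lies below the step, and the slope is nonnegative.\<close>
      case 0
      have "0 \<le> \<bar>snd u\<bar> / \<bar>fst u\<bar> * (real i + 1/2)" by simp
      with 0 show ?thesis by linarith
    next
      case (Suc j')
      have "\<not> A i j'"
      proof
        assume "A i j'"
        then obtain k where k: "a k \<ge> int i + 1" "b k \<le> int j'"
          using vert[of i j'] p unfolding vertical_side_def by metis
        show False
        proof (cases "k \<le> n")
          case True
          with mono(1)[OF True] k ij show False by simp
        next
          case False
          with mono(2)[of n k] k ij Suc show False by simp
        qed
      qed
      from off_nA[OF this] have "\<bar>fst u\<bar> * (real j' + 1/2) \<le> \<bar>snd u\<bar> * (real i + 1/2)"
        by (simp add: ray_offset_def)
      then show ?thesis using u by (simp add: Suc field_simps)
    qed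
    have "\<bar>real j - \<bar>snd u\<bar> / \<bar>fst u\<bar> * (real i + 1/2)\<bar> \<le> 1/2" using lower upper by linarith
    then show ?thesis unfolding stair_eq_0_iff using ij by (simp add: a_def b_def)
  qed
  show "\<exists>n\<ge>N. fst (l n) = X" for N
  proof (rule ccontr)
    assume no: "\<nexists>n. n \<ge> N \<and> fst (l n) = X"
    have const: "a (N + k) = a N" for k
    proof (induction k)
      case (Suc k)
      have "fst (l (N + k)) = Y" using no by (metis gen.exhaust le_add1)
      then obtain e where "l (N + k) = (Y, e)" by (cases "l (N + k)") auto
      then show ?case using Suc by (simp add: a_def)
    qed simp
    have le: "a k \<le> a N" for k
      using mono(1)[of k "N + k"] const[of k] by simp
    obtain i where i: "a N = int i" using nonneg by (metis nonneg_eq_int)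
    \<comment> \<open>High up in column \<open>i\<close> the squares lie on the vertical-axis side,
      so the path has to reach abscissa \<open>i + 1\<close>.\<close>
    obtain j where j: "\<bar>snd u\<bar> * (real i + 1/2) / \<bar>fst u\<bar> < real j" using reals_Archimedean2 by blast
    then have "\<bar>snd u\<bar> * (real i + 1/2) < \<bar>fst u\<bar> * real j" using u by (simp add: field_simps)
    then have "0 < ray_offset u i j" using u by (simp add: ray_offset_def distrib_left)
    then have "A i j" using A by (simp add: square_division_def)
    then obtain k where "a k \<ge> int i + 1" using vert p unfolding vertical_side_def by metis
    with le[of k] i show False by simp
  qed
qed

lemma cartan_ray_staircase:
  fixes u :: "real \<times> real"
  assumes "u \<in> sphere (0, 0) 1" "cartan_ray u \<gamma>"
  obtains \<phi> and s r :: real and l where "staircase_ray \<phi> s l" "\<gamma> = (\<lambda>n. elt (map \<phi> (map l [0..<n])))" "r > 0"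
    "fst u = r * (fst (letter_ab (\<phi> (X, False))) + s * fst (letter_ab (\<phi> (Y, False))))"
    "snd u = r * (snd (letter_ab (\<phi> (X, False))) + s * snd (letter_ab (\<phi> (Y, False))))"
proof -
  note conclude = that
  obtain L where \<gamma>: "\<gamma> = (\<lambda>n. elt (map L [0..<n]))"
    and lat: "lattice_ray u (\<lambda>n. word_ab (map L [0..<n]))"
    using cartan_ray_word[OF assms(2)] .
  have u0: "\<not> (fst u = 0 \<and> snd u = 0)" using assms(1) by (cases u) auto
  have step: "word_ab (map L [0..<Suc n]) = word_ab (map L [0..<n]) + letter_ab (L n)" for n
    by simp
  have sgn: "\<lfloor>sgn x\<rfloor> = (if x < 0 then - 1 else 1)" if "x \<noteq> 0" for x :: real
    using that by (simp add: sgn_if) linarith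
  have straight: thesis
    if axis: "fst u = 0 \<or> snd u = 0"
      and \<phi>: "letter_aut \<phi>" "letter_ab (\<phi> (X, False)) = (\<lfloor>sgn (fst u)\<rfloor>, \<lfloor>sgn (snd u)\<rfloor>)" for \<phi>
  proof -
    have "word_ab (map L [0..<n]) = (int n * \<lfloor>sgn (fst u)\<rfloor>, int n * \<lfloor>sgn (snd u)\<rfloor>)" for n
      using lat axis by (simp add: lattice_ray_def)
    from step[unfolded this] have "letter_ab (L n) = (\<lfloor>sgn (fst u)\<rfloor>, \<lfloor>sgn (snd u)\<rfloor>)" for n
      by (simp add: prod_eq_iff algebra_simps)
    then have "L n = \<phi> (X, False)" for n using \<phi>(2) letter_ab_inject by metis
    then have "L = \<phi> \<circ> (\<lambda>_. (X, False))" by auto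
    then have "\<gamma> = (\<lambda>n. elt (map \<phi> (map (\<lambda>_. (X, False)) [0..<n])))" by (simp add: \<gamma> comp_def)
    then show thesis
      using conclude[OF staircase_ray_straight[OF \<phi>(1)], of "\<bar>fst u\<bar> + \<bar>snd u\<bar>"] axis u0 \<phi>(2)
      by (auto simp: sgn)
  qed
  consider "snd u = 0" | "fst u = 0" | "fst u \<noteq> 0" "snd u \<noteq> 0" by blast
  then show thesis
  proof cases
    case 1
    with u0 show thesis
      by (intro straight[OF _ letter_aut_relabel[of False "fst u < 0" False]]) (simp_all add: sgn)
  next
    case 2
    with u0 show thesis
      by (intro straight[OF _ letter_aut_relabel[of True "snd u < 0" False]]) (simp_all add: sgn)
  next
    case 3
    define \<phi> where "\<phi> = relabel False (fst u < 0) (snd u < 0)"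
    define l where "l n = \<phi> (L n)" for n
    have invol: "\<phi> (\<phi> m) = m" for m
      unfolding \<phi>_def by (cases m; cases "fst m") auto
    have aut: "letter_aut \<phi>" unfolding \<phi>_def by (rule letter_aut_relabel)
    have axes: "letter_ab (\<phi> (X, False)) = (\<lfloor>sgn (fst u)\<rfloor>, 0)" "letter_ab (\<phi> (Y, False)) = (0, \<lfloor>sgn (snd u)\<rfloor>)"
      using 3 by (simp_all add: \<phi>_def sgn)
    obtain A where A: "square_division u A"
      and sides: "\<And>i j. A i j \<Longrightarrow> vertical_side (\<lambda>n. word_ab (map L [0..<n])) i j"
        "\<And>i j. \<not> A i j \<Longrightarrow> horizontal_side (\<lambda>n. word_ab (map L [0..<n])) i j"
      and steps: "\<And>n. word_ab (map L [0..<Suc n]) - word_ab (map L [0..<n])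
        \<in> {(\<lfloor>sgn (fst u)\<rfloor>, 0), (0, \<lfloor>sgn (snd u)\<rfloor>)}"
      using lat 3 unfolding lattice_ray_def by auto
    have "L n = \<phi> (X, False) \<or> L n = \<phi> (Y, False)" for n
    proof -
      have "letter_ab (L n) \<in> {letter_ab (\<phi> (X, False)), letter_ab (\<phi> (Y, False))}"
        using steps[of n] unfolding step axes by simp
      then show ?thesis using letter_ab_inject by blast
    qed
    then have positive: "\<not> snd (l n)" for n
      using invol unfolding l_def by (metis snd_conv)
    have L: "map L [0..<n] = map \<phi> (map l [0..<n])" for n
      by (simp add: l_def invol)
    have pos: "0 \<le> fst (word_ab (map l [0..<n]))" "0 \<le> snd (word_ab (map l [0..<n]))" for n
      using positive_word_ab_mono[of l 0 n] positive by simp_all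
    have p: "\<bar>fst (word_ab (map L [0..<n]))\<bar> = fst (word_ab (map l [0..<n]))"
      "\<bar>snd (word_ab (map L [0..<n]))\<bar> = snd (word_ab (map l [0..<n]))" for n
      using pos[of n] 3 unfolding L word_ab_map[OF aut] axes by (simp_all add: sgn abs_mult)
    have ray: "staircase_ray \<phi> (\<bar>snd u\<bar> / \<bar>fst u\<bar>) l"
      using 3 aut positive p A sides by (rule staircase_ray_of_division)
    have "\<bar>fst u\<bar> > 0" using 3 by simp
    moreover have "\<gamma> = (\<lambda>n. elt (map \<phi> (map l [0..<n])))" by (simp only: \<gamma> L)
    moreover have "fst u = \<bar>fst u\<bar> * (fst (letter_ab (\<phi> (X, False))) + \<bar>snd u\<bar> / \<bar>fst u\<bar> * fst (letter_ab (\<phi> (Y, False))))"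
      "snd u = \<bar>fst u\<bar> * (snd (letter_ab (\<phi> (X, False))) + \<bar>snd u\<bar> / \<bar>fst u\<bar> * snd (letter_ab (\<phi> (Y, False))))"
      using 3 unfolding axes by (simp_all add: sgn)
    ultimately show thesis using conclude[OF ray] by blast
  qed
qed


section \<open>Distinctness and infinite orbits\<close>

lemma eq_of_linear_bound:
  fixes x y :: real
  assumes "\<And>m. \<bar>q m - real m * x\<bar> \<le> 1" "\<And>m. \<bar>q m - real m * y\<bar> \<le> 1"
  shows "x = y"
proof (rule ccontr)
  assume "x \<noteq> y"
  then obtain m where "2 / \<bar>x - y\<bar> < real m" using reals_Archimedean2 by blast
  then have "2 < real m * \<bar>x - y\<bar>" using \<open>x \<noteq> y\<close> by (simp add: field_simps)
  moreover have "real m * \<bar>x - y\<bar> = \<bar>real m * x - real m * y\<bar>"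
    by (simp add: abs_mult flip: right_diff_distrib)
  ultimately show False using assms(1)[of m] assms(2)[of m] by linarith
qed

theorem theoremC:
  fixes \<gamma> :: "real \<times> real \<Rightarrow> nat \<Rightarrow> cartan"
  assumes "\<And>u. u \<in> sphere (0, 0) 1 \<Longrightarrow> cartan_ray u (\<gamma> u)"
  shows "inj_on (\<lambda>u. busemann cartan_group cartan_gens (\<gamma> u)) (sphere (0, 0) 1) \<and>
    (\<forall>u\<in>sphere (0, 0) 1.
       infinite (orbit cartan_group (reduced_act cartan_group)
         (horo_class cartan_group cartan_gens (busemann cartan_group cartan_gens (\<gamma> u)))))"
proof (intro conjI ballI)
  show "inj_on (\<lambda>u. busemann cartan_group cartan_gens (\<gamma> u)) (sphere (0, 0) 1)"
  proof (rule inj_onI)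
    fix u v :: "real \<times> real"
    assume uv: "u \<in> sphere (0, 0) 1" "v \<in> sphere (0, 0) 1"
      and eq: "busemann cartan_group cartan_gens (\<gamma> u) = busemann cartan_group cartan_gens (\<gamma> v)"
    obtain \<phi> and s r :: real and l where ray: "staircase_ray \<phi> s l" "\<gamma> u = (\<lambda>n. elt (map \<phi> (map l [0..<n])))" "r > 0"
      "fst u = r * (fst (letter_ab (\<phi> (X, False))) + s * fst (letter_ab (\<phi> (Y, False))))"
      "snd u = r * (snd (letter_ab (\<phi> (X, False))) + s * snd (letter_ab (\<phi> (Y, False))))"
      using cartan_ray_staircase[OF uv(1) assms[OF uv(1)]] .
    obtain \<phi>' and s' r' :: real and l' where ray': "staircase_ray \<phi>' s' l'" "\<gamma> v = (\<lambda>n. elt (map \<phi>' (map l' [0..<n])))" "r' > 0"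
      "fst v = r' * (fst (letter_ab (\<phi>' (X, False))) + s' * fst (letter_ab (\<phi>' (Y, False))))"
      "snd v = r' * (snd (letter_ab (\<phi>' (X, False))) + s' * snd (letter_ab (\<phi>' (Y, False))))"
      using cartan_ray_staircase[OF uv(2) assms[OF uv(2)]] .
    interpret R: staircase_ray \<phi> s l by (rule ray)
    interpret R': staircase_ray \<phi>' s' l' by (rule ray')
    let ?q = "\<lambda>m. map \<phi>' (map l' [0..<m])"
    have bus': "R'.bus (elt (?q m)) = - real m" for m
      using R'.bus_ray[of m] by (simp only: R'.ray_eq)
    moreover have "R'.bus = R.bus"
      using eq by (simp only: ray(2) ray'(2) R.ray_eq R'.ray_eq)
    ultimately have bus: "R.bus (elt (?q m)) = - real m" for m by simp
    \<comment> \<open>The same words, those of the second ray, follow the direction of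
      \<open>u\<close> and that of \<open>v\<close>, so the l1-normalized vectors agree.\<close>
    have dir: "fst u / (\<bar>fst u\<bar> + \<bar>snd u\<bar>) = fst v / (\<bar>fst v\<bar> + \<bar>snd v\<bar>)"
      "snd u / (\<bar>fst u\<bar> + \<bar>snd u\<bar>) = snd v / (\<bar>fst v\<bar> + \<bar>snd v\<bar>)"
      by (rule eq_of_linear_bound[where q = "\<lambda>m. fst (word_ab (?q m))"];
          rule R.direction(1)[OF _ bus ray(3-5)] R'.direction(1)[OF _ bus' ray'(3-5)]; simp)
        (rule eq_of_linear_bound[where q = "\<lambda>m. snd (word_ab (?q m))"];
          rule R.direction(2)[OF _ bus ray(3-5)] R'.direction(2)[OF _ bus' ray'(3-5)]; simp)
    define c where "c = (\<bar>fst u\<bar> + \<bar>snd u\<bar>) / (\<bar>fst v\<bar> + \<bar>snd v\<bar>)"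
    have "\<bar>fst x\<bar> + \<bar>snd x\<bar> > 0" if "x \<in> sphere (0, 0) 1" for x :: "real \<times> real"
    proof (rule ccontr)
      assume "\<not> \<bar>fst x\<bar> + \<bar>snd x\<bar> > 0"
      then have "fst x = 0" "snd x = 0" by linarith+
      then have "x = (0, 0)" by (simp add: prod_eq_iff)
      with that show False by simp
    qed
    then have nz: "\<bar>fst u\<bar> + \<bar>snd u\<bar> > 0" "\<bar>fst v\<bar> + \<bar>snd v\<bar> > 0" using uv by blast+
    have "u = c *\<^sub>R v" using dir nz by (simp add: c_def prod_eq_iff field_simps)
    moreover from this have "\<bar>c\<bar> = 1" using uv by (simp flip: zero_prod_def)
    moreover have "c > 0" using nz by (simp add: c_def)
    ultimately show "u = v" by simp
  qed
next
  fix u :: "real \<times> real"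
  assume u: "u \<in> sphere (0, 0) 1"
  obtain \<phi> and s r :: real and l where ray: "staircase_ray \<phi> s l" "\<gamma> u = (\<lambda>n. elt (map \<phi> (map l [0..<n])))" "r > 0"
    "fst u = r * (fst (letter_ab (\<phi> (X, False))) + s * fst (letter_ab (\<phi> (Y, False))))"
    "snd u = r * (snd (letter_ab (\<phi> (X, False))) + s * snd (letter_ab (\<phi> (Y, False))))"
    using cartan_ray_staircase[OF u assms[OF u]] .
  interpret R: staircase_ray \<phi> s l by (rule ray)
  have bus: "busemann cartan_group cartan_gens (\<gamma> u) = R.bus"
    by (simp only: ray(2) R.ray_eq)
  let ?C = "horo_class cartan_group cartan_gens R.bus"
  \<comment> \<open>The action evaluates at the inverse, so acting by \<open>g d\<close> translates
    the argument by \<open>shift d\<close> on the left.\<close>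
  define g where "g d = elt (word_inv (R.shift d))" for d
  have "R.bus \<in> ?C"
    using R.bus_in_horoboundary by (auto simp: horo_class_def horo_rel_def intro!: exI[of _ 0])
  have act: "horo_act cartan_group (g d) \<psi> (elt w) = \<psi> (elt (R.shift d @ w)) - \<psi> (elt (R.shift d))" for d \<psi> w
    by (simp add: horo_act_def g_def)
  have "reduced_act cartan_group (g d) ?C \<noteq> reduced_act cartan_group (g (d + e)) ?C" if e: "e \<ge> 1" for d e
  proof
    assume "reduced_act cartan_group (g d) ?C = reduced_act cartan_group (g (d + e)) ?C"
    moreover have "horo_act cartan_group (g (d + e)) R.bus \<in> reduced_act cartan_group (g (d + e)) ?C"
      unfolding reduced_act_def using \<open>R.bus \<in> ?C\<close> by (rule imageI)
    ultimately have "horo_act cartan_group (g (d + e)) R.bus \<in> horo_act cartan_group (g d) ` ?C"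
      by (simp only: reduced_act_def)
    then obtain \<psi> where \<psi>: "\<psi> \<in> ?C"
      "horo_act cartan_group (g (d + e)) R.bus = horo_act cartan_group (g d) \<psi>" by (rule imageE)
    from \<psi>(1) obtain B where B: "\<And>h. \<bar>R.bus h - \<psi> h\<bar> \<le> B"
      by (auto simp: horo_class_def horo_rel_def)
    define B' where "B' = B + \<bar>\<psi> (elt (R.shift d))\<bar> + \<bar>R.bus (elt (R.shift (d + e)))\<bar>"
    obtain m where m: "R.bus (elt (R.shift e @ map \<phi> (map l [0..<m]))) > B' - real m"
      using R.bus_shift_unbounded[OF e] by blast
    let ?W = "map \<phi> (map l [0..<m])"
    \<comment> \<open>\<open>?z\<close> makes \<open>shift d\<close> cancel. One side becomes
      \<open>R.bus\<close> on the translated ray, above \<open>B' - real m\<close>; the other is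
      \<open>\<psi>\<close> on the ray itself, within \<open>B\<close> of \<open>- real m\<close>.
      \<open>B'\<close> absorbs the normalizing constants.\<close>
    let ?z = "word_inv (R.shift d) @ ?W"
    have shift: "R.shift (d + e) = R.shift e @ R.shift d"
      by (simp add: R.shift_def replicate_add[symmetric] algebra_simps)
    have "elt (R.shift (d + e) @ ?z) = elt (R.shift e @ ?W)" "elt (R.shift d @ ?z) = elt ?W"
      using elt_cancel_mid(2)[of "[]" "R.shift d" ?W] by (simp_all add: shift elt_cancel_mid(2) del: map_map)
    then have "R.bus (elt (R.shift e @ ?W)) - R.bus (elt (R.shift (d + e))) = \<psi> (elt ?W) - \<psi> (elt (R.shift d))"
      using fun_cong[OF \<psi>(2), of "elt ?z"] by (simp only: act)
    moreover have "R.bus (elt ?W) = - real m" using R.bus_ray[of m] by (simp only: R.ray_eq)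
    ultimately show False using m B[of "elt ?W"] unfolding B'_def by linarith
  qed
  then have ne: "reduced_act cartan_group (g d) ?C \<noteq> reduced_act cartan_group (g d') ?C" if "d < d'" for d d'
    using that by (metis less_imp_add_positive One_nat_def Suc_leI)
  have "inj (\<lambda>d. reduced_act cartan_group (g d) ?C)"
    by (rule linorder_injI) (rule ne)
  then have "infinite (range (\<lambda>d. reduced_act cartan_group (g d) ?C))"
    by (rule range_inj_infinite)
  moreover have "range (\<lambda>d. reduced_act cartan_group (g d) ?C)
      \<subseteq> orbit cartan_group (reduced_act cartan_group) ?C"
    by (auto simp: orbit_def)
  ultimately show "infinite (orbit cartan_group (reduced_act cartan_group)
      (horo_class cartan_group cartan_gens (busemann cartan_group cartan_gens (\<gamma> u))))"
    unfolding bus by (metis finite_subset)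
qed

end
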